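(* Let $\alpha,\beta>-1$. There exists a real number $\sigma>-1$ such that \[ (n+\sigma)\,\theta_{n,k}^{(\alpha,\beta)}\leq(n+1+\sigma)\,\theta_{n+1,k}^{(\alpha,\beta)} \] for every integer $n\geq1$ and every $1\leq k\leq n$ if and only if $|\beta|\leq\frac12$.
   Context: $P_n^{(\alpha,\beta)}$ denotes the Jacobi polynomial of degree $n$ (orthogonal on $(-1,1)$ with respect to the weight $(1-x)^\alpha(1+x)^\beta$). For $\alpha,\beta>-1$ its $n$ zeros are simple and lie in $(-1,1)$; they are written $\cos\theta_{n,k}^{(\alpha,\beta)}$, $1\le k\le n$, with $0<\theta_{n,1}^{(\alpha,\beta)}<\cdots<\theta_{n,n}^{(\alpha,\beta)}<\pi$. *)

theory Defs
  imports "HOL-Analysis.Analysis" "HOL-Computational_Algebra.Polynomial"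
begin

text \<open>
  The Jacobi polynomial is the polynomial of degree \<open>n\<close> that is orthogonal, with respect to the
  weight \<open>(1 - x)\<^sup>\<alpha> (1 + x)\<^sup>\<beta>\<close> on \<open>(-1, 1)\<close>, to every polynomial of degree less than \<open>n\<close>, with
  Szego's normalization \<open>P\<^sub>n(1) = binom (n + \<alpha>) n\<close>. It exists and is unique for \<open>\<alpha>, \<beta> > -1\<close>, and the
  definition is only meant to be used in that range. The endpoints of the integration interval
  are negligible.
\<close>

definition jacobi_poly :: "real \<Rightarrow> real \<Rightarrow> nat \<Rightarrow> real poly" where
  "jacobi_poly \<alpha> \<beta> n = (THE p. degree p = n \<and>
     (\<forall>q. degree q < n \<longrightarrow>
        ((\<lambda>x. poly p x * poly q x * ((1 - x) powr \<alpha> * (1 + x) powr \<beta>)) has_integral 0) {-1..1}) \<and>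
     poly p 1 = (real n + \<alpha>) gchoose n)"

text \<open>
  The \<open>k\<close>-th smallest \<open>\<theta> \<in> (0, \<pi>)\<close> for which \<open>cos \<theta>\<close> is a zero of the Jacobi polynomial. The index
  starts at 1, as in the usual notation, whereas list positions start at 0; the value is
  meaningful for \<open>1 \<le> k \<le> n\<close>.
\<close>

definition jacobi_theta :: "real \<Rightarrow> real \<Rightarrow> nat \<Rightarrow> nat \<Rightarrow> real" where
  "jacobi_theta \<alpha> \<beta> n k =
     sorted_list_of_set {\<theta>. 0 < \<theta> \<and> \<theta> < pi \<and> poly (jacobi_poly \<alpha> \<beta> n) (cos \<theta>) = 0} ! (k - 1)"

end

theory Submission
  imports Defs "HOL-Real_Asymp.Real_Asymp"
begin

text \<open>
  Write \<open>A = 1/4 - \<alpha>\<^sup>2\<close>, \<open>B = 1/4 - \<beta>\<^sup>2\<close> and \<open>\<rho> = (\<alpha> + \<beta> + 1) / 2\<close>. The function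
  \<open>u(\<theta>) = sin(\<theta>/2)\<close> to the power \<open>\<alpha> + 1/2\<close> times \<open>cos(\<theta>/2)\<close> to the power \<open>\<beta> + 1/2\<close> times
  \<open>P\<^sub>n(cos \<theta>)\<close> has the zeros \<open>\<theta>\<^sub>n\<^sub>,\<^sub>k\<close> and satisfies \<open>u'' + Q\<^sub>n u = 0\<close> on \<open>(0, \<pi>)\<close>, where
  \<open>Q\<^sub>n(\<theta>) = (n + \<rho>)\<^sup>2 + A / (4 sin\<^sup>2(\<theta>/2)) + B / (4 cos\<^sup>2(\<theta>/2))\<close>
  (\<open>DERIV_liouville_deriv\<close>). Both directions compare such equations by Sturm's theorem
  (\<open>sturm_comparison\<close>).

  If \<open>\<bar>\<beta>\<bar> \<le> 1/2\<close>, the choice \<open>\<sigma> = -1/2\<close> works for every \<open>\<alpha>\<close>. In the variable \<open>\<phi> = (n - 1/2) \<theta>\<close>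
  the potential becomes \<open>s\<^sup>2 Q\<^sub>n(s \<phi>)\<close> with \<open>s = 1 / (n - 1/2) \<le> 2\<close>, and at fixed \<open>\<phi>\<close> this is
  strictly increasing in \<open>s\<close>, hence decreasing in \<open>n\<close> (\<open>scaled_liouville_potential_less\<close>): the term
  in \<open>B \<ge> 0\<close> helps, and if \<open>A < 0\<close> the growth of \<open>s\<^sup>2 (n + \<rho>)\<^sup>2\<close> outweighs the term in \<open>A\<close>. A
  smaller potential has its zeros further to the right, so the scaled zeros increase with \<open>n\<close>
  (\<open>jacobi_scaled_interlacing\<close>). The comparison starts at the singular endpoint \<open>0\<close>, which is
  possible since both solutions have the same exponent \<open>\<alpha> + 1/2 > -1/2\<close> there and their Wronskian
  therefore vanishes (\<open>liouville_wronskian_limit\<close>).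

  If \<open>\<bar>\<beta>\<bar> > 1/2\<close>, then \<open>B < 0\<close>, and at distance of order \<open>1/n\<close> from \<open>\<pi>\<close> the singular term lowers
  \<open>Q\<^sub>n\<close> by a fixed proportion of \<open>n\<^sup>2\<close>. The last two zeros lie that close to \<open>\<pi>\<close>
  (\<open>penultimate_jacobi_angle_near_pi\<close>), so their distance exceeds \<open>\<pi> / (\<kappa> n)\<close> with a constant
  \<open>\<kappa> < 1\<close> (\<open>last_jacobi_gap_large\<close>). Given an admissible \<open>\<sigma>\<close>, put
  \<open>d\<^sub>n = (n + \<sigma>) (\<pi> - \<theta>\<^sub>n\<^sub>,\<^sub>n)\<close>. The inequality for \<open>k = n\<close> compares \<open>\<theta>\<^sub>n\<^sub>,\<^sub>n\<close> with the second
  to last zero of the next polynomial and yields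
  \<open>d\<^sub>n\<^sub>+\<^sub>1 \<le> d\<^sub>n + \<pi> - (n + 1 + \<sigma>) (\<theta>\<^sub>n\<^sub>+\<^sub>1\<^sub>,\<^sub>n\<^sub>+\<^sub>1 - \<theta>\<^sub>n\<^sub>+\<^sub>1\<^sub>,\<^sub>n)\<close>, which is eventually at most
  \<open>d\<^sub>n - \<delta>\<close> with a constant \<open>\<delta> > 0\<close>. This is absurd, as all \<open>d\<^sub>n\<close> are positive.
\<close>

section \<open>The Jacobi operator and its polynomial eigenfunctions\<close>

text \<open>
  The differential operator \<open>(1 - x\<^sup>2) q'' + (\<beta> - \<alpha> - (\<alpha> + \<beta> + 2) x) q'\<close> of Jacobi's equation. It maps
  polynomials of degree \<open>n\<close> to polynomials of degree at most \<open>n\<close>.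
\<close>

definition jacobi_op :: "real \<Rightarrow> real \<Rightarrow> real poly \<Rightarrow> real poly" where
  "jacobi_op \<alpha> \<beta> q = [:1, 0, -1:] * pderiv (pderiv q) + [:\<beta> - \<alpha>, - (\<alpha> + \<beta> + 2):] * pderiv q"

definition jacobi_eigenvalue :: "real \<Rightarrow> real \<Rightarrow> nat \<Rightarrow> real" where
  "jacobi_eigenvalue \<alpha> \<beta> n = real n * (real n + \<alpha> + \<beta> + 1)"

lemma poly_jacobi_op:
  "poly (jacobi_op \<alpha> \<beta> q) x =
     (1 - x\<^sup>2) * poly (pderiv (pderiv q)) x
     + (\<beta> - \<alpha> - (\<alpha> + \<beta> + 2) * x) * poly (pderiv q) x"
  by (simp add: jacobi_op_def algebra_simps power2_eq_square)

text \<open>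
  On monomials the operator is triangular, with the negated eigenvalues on the diagonal.
\<close>

lemma coeff_jacobi_op:
  "coeff (jacobi_op \<alpha> \<beta> q) i =
     (real i + 2) * (real i + 1) * coeff q (i + 2) + (\<beta> - \<alpha>) * (real i + 1) * coeff q (i + 1)
     - jacobi_eigenvalue \<alpha> \<beta> i * coeff q i"
proof -
  consider "i = 0" | "i = 1" | k where "i = Suc (Suc k)"
    by (metis One_nat_def not0_implies_Suc)
  then show ?thesis
  proof cases
    case 3
    have "coeff (jacobi_op \<alpha> \<beta> q) i =
       (coeff (pderiv (pderiv q)) i - coeff (pderiv (pderiv q)) k)
       + (\<beta> - \<alpha>) * coeff (pderiv q) i - (\<alpha> + \<beta> + 2) * coeff (pderiv q) (Suc k)"
      by (simp add: 3 jacobi_op_def) (simp add: algebra_simps)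
    then show ?thesis
      by (simp add: 3 coeff_pderiv jacobi_eigenvalue_def) (simp add: algebra_simps)
  qed (simp_all add: jacobi_op_def jacobi_eigenvalue_def coeff_pderiv algebra_simps)
qed

text \<open>
  The difference of two eigenvalues is \<open>(m - n) (m + n + \<alpha> + \<beta> + 1)\<close>, and the second factor is
  positive as soon as one of \<open>m, n\<close> is not zero.
\<close>

lemma jacobi_eigenvalue_eq_iff:
  assumes "\<alpha> > -1" "\<beta> > -1"
  shows "jacobi_eigenvalue \<alpha> \<beta> m = jacobi_eigenvalue \<alpha> \<beta> n \<longleftrightarrow> m = n"
proof
  assume eq: "jacobi_eigenvalue \<alpha> \<beta> m = jacobi_eigenvalue \<alpha> \<beta> n"
  show "m = n"
  proof (rule ccontr)
    assume "m \<noteq> n"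
    then have "real m + real n \<ge> 1" by linarith
    then have "real m + real n + \<alpha> + \<beta> + 1 > 0" using assms by linarith
    moreover have "(real m - real n) * (real m + real n + \<alpha> + \<beta> + 1) = 0"
      using eq by (simp add: jacobi_eigenvalue_def algebra_simps)
    ultimately show False using \<open>m \<noteq> n\<close> by simp
  qed
qed simp

lemma gchoose_shifted_pos:
  fixes a :: real
  assumes "a > -1"
  shows "(real n + a) gchoose n > 0"
proof -
  have "(\<Prod>i = 0..<n. real n + a - real i) > 0"
    using assms by (intro prod_pos) auto
  then show ?thesis by (simp add: gbinomial_prod_rev)
qed

text \<open>
  In powers of \<open>1 - x\<close> the differential equation is a two-term recursion for the coefficients. Its
  factor vanishes exactly at the step from \<open>n\<close> to \<open>n + 1\<close>, since the eigenvalues are distinct;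
  hence the series stops and has degree \<open>n\<close>. The value at \<open>1\<close> is the free initial coefficient.
\<close>

lemma jacobi_eigenpolynomial_exists:
  assumes \<alpha>: "\<alpha> > -1" and \<beta>: "\<beta> > -1"
  shows "\<exists>p. degree p = n
     \<and> jacobi_op \<alpha> \<beta> p = smult (- jacobi_eigenvalue \<alpha> \<beta> n) p
     \<and> poly p 1 = (real n + \<alpha>) gchoose n"
proof -
  define l where "l = jacobi_eigenvalue \<alpha> \<beta>"
  define c where "c = rec_nat ((real n + \<alpha>) gchoose n)
     (\<lambda>j r. r * (l j - l n) / (2 * (real j + 1) * (real j + \<alpha> + 1)))"
  have c0: "c 0 = (real n + \<alpha>) gchoose n" by (simp add: c_def)
  have pos: "2 * (real j + 1) * (real j + \<alpha> + 1) > 0" for j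
    using \<alpha> by (intro mult_pos_pos) auto
  have cS: "c (Suc j) * (2 * (real j + 1) * (real j + \<alpha> + 1)) = c j * (l j - l n)" for j
  proof -
    have "c (Suc j) = c j * (l j - l n) / (2 * (real j + 1) * (real j + \<alpha> + 1))"
      by (simp add: c_def)
    then show ?thesis using pos[of j] nonzero_eq_divide_eq by (metis less_irrefl)
  qed
  have lne: "l j = l m \<longleftrightarrow> j = m" for j m
    unfolding l_def by (rule jacobi_eigenvalue_eq_iff[OF \<alpha> \<beta>])
  have cnz: "c j \<noteq> 0" if "j \<le> n" for j
    using that
  proof (induction j)
    case 0
    then show ?case using gchoose_shifted_pos[OF \<alpha>, of n] c0 by simp
  next
    case (Suc j)
    then have "c j * (l j - l n) \<noteq> 0" using lne[of j n] by simp
    then show ?case using cS[of j] by auto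
  qed
  have cz: "c j = 0" if "j > n" for j
    using that
  proof (induction j)
    case (Suc j)
    then have "c j * (l j - l n) = 0" by (cases "j = n") auto
    then show ?case using cS[of j] pos[of j] by (metis less_irrefl mult_eq_0_iff)
  qed simp
  define q where "q = (\<Sum>j\<le>n. monom (c j) j)"
  have cq: "coeff q j = c j" for j
    unfolding q_def coeff_sum using cz[of j]
    by (cases "j \<le> n") auto
  have degq: "degree q = n"
  proof (rule antisym)
    show "degree q \<le> n" by (intro degree_le) (simp add: cq cz)
    show "n \<le> degree q" by (intro le_degree) (simp add: cq cnz)
  qed
  \<comment> \<open>Jacobi's equation in the variable \<open>1 - x\<close>\<close>
  have ode: "[:0, 2, -1:] * pderiv (pderiv q) + [:2 * (\<alpha> + 1), - (\<alpha> + \<beta> + 2):] * pderiv q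
      = smult (- l n) q"
  proof (rule poly_eqI)
    fix j
    have "coeff ([:0, 2, -1:] * pderiv (pderiv q)
             + [:2 * (\<alpha> + 1), - (\<alpha> + \<beta> + 2):] * pderiv q) j
        = c (Suc j) * (2 * (real j + 1) * (real j + \<alpha> + 1)) - l j * c j"
      by (cases j; cases "j - 1")
        (auto simp: coeff_pderiv cq l_def jacobi_eigenvalue_def algebra_simps coeff_pCons
              split: nat.split)
    then show "coeff ([:0, 2, -1:] * pderiv (pderiv q)
             + [:2 * (\<alpha> + 1), - (\<alpha> + \<beta> + 2):] * pderiv q) j = coeff (smult (- l n) q) j"
      unfolding cS by (simp add: cq algebra_simps)
  qed
  define p where "p = pcompose q [:1, -1:]"
  have p: "poly p x = poly q (1 - x)" for x
    by (simp add: p_def poly_pcompose)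
  have dp: "poly (pderiv p) x = - poly (pderiv q) (1 - x)" for x
    by (simp add: p_def pderiv_pcompose pderiv_pCons poly_pcompose)
  have ddp: "poly (pderiv (pderiv p)) x = poly (pderiv (pderiv q)) (1 - x)" for x
    by (simp add: p_def pderiv_pcompose pderiv_pCons pderiv_minus poly_pcompose)
  have "jacobi_op \<alpha> \<beta> p = smult (- l n) p"
  proof -
    have "poly (jacobi_op \<alpha> \<beta> p) x = poly (smult (- l n) p) x" for x
      using arg_cong[OF ode, of "\<lambda>r. poly r (1 - x)"]
      by (simp add: poly_jacobi_op p dp ddp algebra_simps power2_eq_square)
    then show ?thesis by (simp add: poly_eq_poly_eq_iff[symmetric] fun_eq_iff)
  qed
  moreover have "degree p = n" by (simp add: p_def degree_pcompose degq)
  moreover have "poly p 1 = (real n + \<alpha>) gchoose n"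
    by (simp add: p_def poly_pcompose poly_0_coeff_0 cq c0)
  ultimately show ?thesis by (auto simp: l_def)
qed

section \<open>Orthogonality, uniqueness and zeros\<close>

text \<open>
  Continuity is only available in the interior, because the Jacobi weight may be unbounded at the
  endpoints; so the integral is first restricted to a compact subinterval around \<open>x\<close>.
\<close>

lemma has_integral_0_nonneg_imp_0:
  fixes f :: "real \<Rightarrow> real"
  assumes int: "(f has_integral 0) {a..b}"
    and nonneg: "\<And>x. x \<in> {a..b} \<Longrightarrow> f x \<ge> 0"
    and cont: "continuous_on {a<..<b} f"
    and x: "x \<in> {a<..<b}"
  shows "f x = 0"
proof -
  define c d where "c = (a + x) / 2" and "d = (x + b) / 2"
  have cd: "a < c" "c < x" "x < d" "d < b" using x by (auto simp: c_def d_def)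
  have sub: "{c..d} \<subseteq> {a..b}" using cd by auto
  have fi: "f integrable_on {c..d}"
    using integrable_on_subinterval[OF has_integral_integrable[OF int]] sub by auto
  have "integral {c..d} f \<le> integral {a..b} f"
    by (rule integral_subset_le[OF sub fi has_integral_integrable[OF int]]) (use nonneg in auto)
  moreover have "integral {c..d} f \<ge> 0"
    by (rule integral_nonneg[OF fi]) (use nonneg sub in auto)
  ultimately have "integral {c..d} f = 0" using integral_unique[OF int] by simp
  then have "(f has_integral 0) (cbox c d)" using fi by (simp add: has_integral_iff)
  then show ?thesis
    by (rule has_integral_0_cbox_imp_0[rotated 2])
      (use cd nonneg in \<open>auto intro: continuous_on_subset[OF cont]\<close>)
qed

definition jacobi_weight :: "real \<Rightarrow> real \<Rightarrow> real \<Rightarrow> real" where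
  "jacobi_weight \<alpha> \<beta> x = (1 - x) powr \<alpha> * (1 + x) powr \<beta>"

text \<open>
  The integrand is the derivative of
  \<open>(1 - x) powr (\<alpha> + 1) * (1 + x) powr (\<beta> + 1) * (p q' - q p')\<close>. As \<open>\<alpha> + 1\<close> and \<open>\<beta> + 1\<close> are
  positive, this is continuous up to the endpoints and vanishes there.
\<close>

lemma jacobi_op_self_adjoint:
  assumes \<alpha>: "\<alpha> > -1" and \<beta>: "\<beta> > -1"
  shows "((\<lambda>x. (poly p x * poly (jacobi_op \<alpha> \<beta> q) x - poly q x * poly (jacobi_op \<alpha> \<beta> p) x)
      * jacobi_weight \<alpha> \<beta> x) has_integral 0) {-1..1}"
proof -
  define w where "w x = poly p x * poly (pderiv q) x - poly q x * poly (pderiv p) x" for x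
  define G where "G x = (1 - x) powr (\<alpha> + 1) * (1 + x) powr (\<beta> + 1) * w x" for x
  have cont: "continuous_on {-1..1} G"
    unfolding G_def w_def by (intro continuous_intros continuous_on_powr') (use \<alpha> \<beta> in auto)
  have der: "(G has_vector_derivative
      (poly p x * poly (jacobi_op \<alpha> \<beta> q) x - poly q x * poly (jacobi_op \<alpha> \<beta> p) x)
      * jacobi_weight \<alpha> \<beta> x) (at x)" if "x \<in> {-1<..<1}" for x
  proof -
    have w': "(w has_real_derivative
        (poly p x * poly (pderiv (pderiv q)) x - poly q x * poly (pderiv (pderiv p)) x)) (at x)"
      unfolding w_def by (auto intro!: derivative_eq_intros simp: algebra_simps)
    have p1: "((\<lambda>x. (1 - x) powr (\<alpha> + 1)) has_real_derivative
        - ((\<alpha> + 1) * (1 - x) powr \<alpha>)) (at x)"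
      using that by (auto intro!: derivative_eq_intros)
    have p2: "((\<lambda>x. (1 + x) powr (\<beta> + 1)) has_real_derivative
        (\<beta> + 1) * (1 + x) powr \<beta>) (at x)"
      using that by (auto intro!: derivative_eq_intros)
    have s: "(1 - x) powr (\<alpha> + 1) = (1 - x) powr \<alpha> * (1 - x)"
      "(1 + x) powr (\<beta> + 1) = (1 + x) powr \<beta> * (1 + x)"
      using that by (auto simp: powr_add)
    show ?thesis unfolding has_real_derivative_iff_has_vector_derivative[symmetric] G_def
      by (rule DERIV_cong[OF DERIV_mult[OF DERIV_mult[OF p1 p2] w']])
        (simp only: s poly_jacobi_op w_def jacobi_weight_def, simp add: field_simps power2_eq_square)
  qed
  have "G 1 = 0" "G (-1) = 0" by (auto simp: G_def)
  then show ?thesis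
    using fundamental_theorem_of_calculus_interior[OF _ cont der] by simp
qed

definition jacobi_orthogonal :: "real \<Rightarrow> real \<Rightarrow> real poly \<Rightarrow> bool" where
  "jacobi_orthogonal \<alpha> \<beta> p \<longleftrightarrow> (\<forall>q. degree q < degree p \<longrightarrow>
     ((\<lambda>x. poly p x * poly q x * jacobi_weight \<alpha> \<beta> x) has_integral 0) {-1..1})"

text \<open>
  By self-adjointness, applying the operator to \<open>q\<close> of degree \<open>m < n\<close> instead of \<open>p\<close> shows that the
  difference of the eigenvalues of \<open>n\<close> and \<open>m\<close>, times the integral, equals the integral of \<open>p\<close>
  against a polynomial of degree less than \<open>m\<close>, so induction on \<open>m\<close> applies.
\<close>

lemma jacobi_eigenpolynomial_orthogonal:
  assumes \<alpha>: "\<alpha> > -1" and \<beta>: "\<beta> > -1"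
    and eigen: "jacobi_op \<alpha> \<beta> p = smult (- jacobi_eigenvalue \<alpha> \<beta> (degree p)) p"
  shows "jacobi_orthogonal \<alpha> \<beta> p"
proof -
  let ?l = "jacobi_eigenvalue \<alpha> \<beta>"
  let ?n = "degree p"
  have "((\<lambda>x. poly p x * poly q x * jacobi_weight \<alpha> \<beta> x) has_integral 0) {-1..1}"
    if "degree q < ?n" for q
    using that
  proof (induction "degree q" arbitrary: q rule: less_induct)
    case less
    let ?m = "degree q"
    \<comment> \<open>The leading terms cancel, so \<open>r\<close> is \<open>0\<close> or has smaller degree than \<open>q\<close>.\<close>
    define r where "r = jacobi_op \<alpha> \<beta> q + smult (?l ?m) q"
    have cr: "coeff r i = 0" if "i \<ge> ?m" for i
      using that by (cases "i = ?m") (auto simp: r_def coeff_jacobi_op coeff_eq_0)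
    have r: "((\<lambda>x. poly p x * poly r x * jacobi_weight \<alpha> \<beta> x) has_integral 0) {-1..1}"
    proof (cases "r = 0")
      case False
      then have "coeff r (degree r) \<noteq> 0" by simp
      then have "degree r < ?m" using cr not_le by blast
      then show ?thesis using less by simp
    qed simp
    have q: "poly (jacobi_op \<alpha> \<beta> q) x = poly r x - ?l ?m * poly q x" for x
      by (simp add: r_def)
    have p: "poly (jacobi_op \<alpha> \<beta> p) x = - ?l ?n * poly p x" for x
      by (simp add: eigen)
    have "((\<lambda>x. (?l ?n - ?l ?m) * (poly p x * poly q x * jacobi_weight \<alpha> \<beta> x))
        has_integral 0) {-1..1}"
      using has_integral_diff[OF jacobi_op_self_adjoint[OF \<alpha> \<beta>, of p q] r]
      by (simp add: q p algebra_simps)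
    from has_integral_mult_right[OF this, of "inverse (?l ?n - ?l ?m)"]
    have "((\<lambda>x. inverse (?l ?n - ?l ?m) *
        ((?l ?n - ?l ?m) * (poly p x * poly q x * jacobi_weight \<alpha> \<beta> x))) has_integral 0) {-1..1}"
      by simp
    moreover have "?l ?n - ?l ?m \<noteq> 0"
      using jacobi_eigenvalue_eq_iff[OF \<alpha> \<beta>] less.prems by simp
    ultimately show ?case by (simp flip: mult.assoc)
  qed
  then show ?thesis by (simp add: jacobi_orthogonal_def)
qed

lemma jacobi_weight_nonneg: "jacobi_weight \<alpha> \<beta> x \<ge> 0"
  by (simp add: jacobi_weight_def)

lemma jacobi_weight_pos: "-1 < x \<Longrightarrow> x < 1 \<Longrightarrow> jacobi_weight \<alpha> \<beta> x > 0"
  by (simp add: jacobi_weight_def)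

lemma continuous_on_jacobi_weight: "continuous_on {-1<..<1} (jacobi_weight \<alpha> \<beta>)"
  unfolding jacobi_weight_def by (intro continuous_intros) auto

lemma poly_eq_0_if_weighted_integral_eq_0:
  assumes int: "((\<lambda>x. poly p x * jacobi_weight \<alpha> \<beta> x) has_integral 0) {-1..1}"
    and nonneg: "\<And>x. -1 < x \<Longrightarrow> x < 1 \<Longrightarrow> poly p x \<ge> 0"
  shows "p = 0"
proof (rule ccontr)
  assume "p \<noteq> 0"
  have "poly p x = 0" if "x \<in> {-1<..<1}" for x
  proof -
    have nn: "poly p y * jacobi_weight \<alpha> \<beta> y \<ge> 0" if "y \<in> {-1..1}" for y
    proof (cases "y = -1 \<or> y = 1")
      case True
      then show ?thesis by (auto simp: jacobi_weight_def)
    next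
      case False
      then show ?thesis using that nonneg[of y] jacobi_weight_nonneg by auto
    qed
    have "poly p x * jacobi_weight \<alpha> \<beta> x = 0"
      by (rule has_integral_0_nonneg_imp_0[OF int nn _ that])
        (auto intro!: continuous_on_mult continuous_on_poly continuous_on_jacobi_weight)
    then show ?thesis using jacobi_weight_pos[of x \<alpha> \<beta>] that by auto
  qed
  then have "{-1<..<1} \<subseteq> {x. poly p x = 0}" by blast
  then have "finite {-1<..<1::real}"
    using poly_roots_finite[OF \<open>p \<noteq> 0\<close>] finite_subset by blast
  then show False by (simp add: infinite_Ioo)
qed

text \<open>
  Subtracting a multiple of \<open>q\<close> from \<open>p\<close> cancels the leading term, and the remainder is orthogonal
  to itself.
\<close>

lemma jacobi_orthogonal_unique:
  assumes "degree p = n" "degree q = n"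
    and p: "jacobi_orthogonal \<alpha> \<beta> p" and q: "jacobi_orthogonal \<alpha> \<beta> q"
    and "poly p 1 = poly q 1" "poly q 1 \<noteq> 0"
  shows "p = q"
proof -
  have q0: "q \<noteq> 0" using assms by auto
  define c where "c = lead_coeff p / lead_coeff q"
  define r where "r = p - smult c q"
  have cr: "coeff r i = 0" if "i \<ge> n" for i
  proof (cases "i = n")
    case True
    then have "c * coeff q i = coeff p i" using q0 assms(1,2) leading_coeff_neq_0[OF q0] by (simp add: c_def)
    then show ?thesis by (simp add: r_def)
  next
    case False
    then show ?thesis using that assms(1,2) by (simp add: r_def coeff_eq_0)
  qed
  have "r = 0"
  proof (rule ccontr)
    assume "r \<noteq> 0"
    then have "coeff r (degree r) \<noteq> 0" by simp
    then have deg: "degree r < n" using cr not_le by blast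
    have "((\<lambda>x. poly p x * poly r x * jacobi_weight \<alpha> \<beta> x) has_integral 0) {-1..1}"
      "((\<lambda>x. poly q x * poly r x * jacobi_weight \<alpha> \<beta> x) has_integral 0) {-1..1}"
      using p q deg assms(1,2) by (auto simp: jacobi_orthogonal_def)
    from has_integral_diff[OF this(1) has_integral_mult_right[OF this(2), of c]]
    have "((\<lambda>x. poly (r * r) x * jacobi_weight \<alpha> \<beta> x) has_integral 0) {-1..1}"
      by (simp add: r_def algebra_simps)
    then have "r * r = 0" by (rule poly_eq_0_if_weighted_integral_eq_0) simp
    with \<open>r \<noteq> 0\<close> show False by simp
  qed
  then have "poly p 1 = c * poly q 1" by (simp add: r_def)
  then have "c = 1" using assms by simp
  then show ?thesis using \<open>r = 0\<close> by (simp add: r_def)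
qed

text \<open>
  The eigenpolynomial meets the characterization of the Jacobi polynomial, so that the latter
  inherits Jacobi's equation.
\<close>

lemma jacobi_poly:
  assumes \<alpha>: "\<alpha> > -1" and \<beta>: "\<beta> > -1"
  shows "degree (jacobi_poly \<alpha> \<beta> n) = n"
    and "jacobi_op \<alpha> \<beta> (jacobi_poly \<alpha> \<beta> n) = smult (- jacobi_eigenvalue \<alpha> \<beta> n) (jacobi_poly \<alpha> \<beta> n)"
    and "jacobi_poly \<alpha> \<beta> n \<noteq> 0"
proof -
  obtain p where p: "degree p = n" "jacobi_op \<alpha> \<beta> p = smult (- jacobi_eigenvalue \<alpha> \<beta> n) p"
    "poly p 1 = (real n + \<alpha>) gchoose n"
    using jacobi_eigenpolynomial_exists[OF \<alpha> \<beta>] by blast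
  have orth: "jacobi_orthogonal \<alpha> \<beta> p"
    using jacobi_eigenpolynomial_orthogonal[OF \<alpha> \<beta>] p by simp
  have "jacobi_poly \<alpha> \<beta> n = (THE q. degree q = n \<and> jacobi_orthogonal \<alpha> \<beta> q
      \<and> poly q 1 = (real n + \<alpha>) gchoose n)"
    unfolding jacobi_poly_def jacobi_orthogonal_def jacobi_weight_def
    by (intro arg_cong[of _ _ The] ext) auto
  also have "\<dots> = p"
    using p orth gchoose_shifted_pos[OF \<alpha>, of n]
    by (intro the_equality) (auto intro: jacobi_orthogonal_unique)
  finally have "jacobi_poly \<alpha> \<beta> n = p" .
  moreover have "p \<noteq> 0" using p(3) gchoose_shifted_pos[OF \<alpha>, of n] by auto
  ultimately show "degree (jacobi_poly \<alpha> \<beta> n) = n"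
    "jacobi_op \<alpha> \<beta> (jacobi_poly \<alpha> \<beta> n) = smult (- jacobi_eigenvalue \<alpha> \<beta> n) (jacobi_poly \<alpha> \<beta> n)"
    "jacobi_poly \<alpha> \<beta> n \<noteq> 0"
    using p by auto
qed

text \<open>
  The set \<open>S\<close> collects the roots of odd multiplicity in \<open>I\<close>; all other roots in \<open>I\<close> have been paired
  off into the square.
\<close>

lemma poly_odd_root_decomposition:
  fixes p :: "real poly"
  assumes "p \<noteq> 0"
  shows "\<exists>s S r. finite S \<and> S \<subseteq> I \<and> p = s\<^sup>2 * (\<Prod>a\<in>S. [:-a, 1:]) * r \<and> (\<forall>x\<in>I. poly r x \<noteq> 0)"
  using assms
proof (induction "degree p" arbitrary: p rule: less_induct)
  case less
  show ?case
  proof (cases "\<exists>a\<in>I. poly p a = 0")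
    case False
    then show ?thesis by (intro exI[of _ 1] exI[of _ "{}"] exI[of _ p]) auto
  next
    case True
    then obtain a where a: "a \<in> I" "poly p a = 0" by blast
    then obtain p' where p': "p = [:-a, 1:] * p'" by (auto simp: poly_eq_0_iff_dvd dvd_def)
    with less.prems have "p' \<noteq> 0" by auto
    moreover have "degree p' < degree p"
      unfolding p' using \<open>p' \<noteq> 0\<close> by (subst degree_mult_eq) auto
    ultimately obtain s S r where d: "finite S" "S \<subseteq> I" "p' = s\<^sup>2 * (\<Prod>a\<in>S. [:-a, 1:]) * r"
      "\<forall>x\<in>I. poly r x \<noteq> 0"
      using less.hyps by blast
    show ?thesis
    proof (cases "a \<in> S")
      case False
      have "(\<Prod>a\<in>insert a S. [:-a, 1:]) = [:-a, 1:] * (\<Prod>a\<in>S. [:-a, 1:])"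
        by (rule prod.insert[OF d(1) False])
      then have "p = s\<^sup>2 * (\<Prod>a\<in>insert a S. [:-a, 1:]) * r"
        unfolding p' d(3) by (simp only: ac_simps)
      then show ?thesis using d(1,2,4) a(1)
        by (intro exI[of _ s] exI[of _ "insert a S"] exI[of _ r]) blast
    next
      case True
      have "(\<Prod>a\<in>S. [:-a, 1:]) = [:-a, 1:] * (\<Prod>a\<in>S - {a}. [:-a, 1:])"
        by (rule prod.remove[OF d(1) True])
      then have "p = ([:-a, 1:] * s)\<^sup>2 * (\<Prod>a\<in>S - {a}. [:-a, 1:]) * r"
        unfolding p' d(3) power2_eq_square by (simp only: ac_simps)
      then show ?thesis using d(1,2,4)
        by (intro exI[of _ "[:-a, 1:] * s"] exI[of _ "S - {a}"] exI[of _ r]) blast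
    qed
  qed
qed

text \<open>
  If \<open>p\<close> had fewer than \<open>degree p\<close> sign changes, multiplying it by the linear factors at these sign
  changes would give a polynomial of constant sign on \<open>(-1, 1)\<close> with vanishing weighted integral.
\<close>

lemma jacobi_orthogonal_card_roots:
  assumes orth: "jacobi_orthogonal \<alpha> \<beta> p" and "p \<noteq> 0"
  shows "card {x. -1 < x \<and> x < 1 \<and> poly p x = 0} = degree p"
proof -
  let ?Z = "{x. -1 < x \<and> x < 1 \<and> poly p x = 0}"
  have fin: "finite {x. poly p x = 0}" by (rule poly_roots_finite[OF \<open>p \<noteq> 0\<close>])
  have "card ?Z \<le> card {x. poly p x = 0}" by (intro card_mono fin) auto
  then have le: "card ?Z \<le> degree p" using card_poly_roots_bound[OF \<open>p \<noteq> 0\<close>] by linarith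
  obtain s S r where d: "finite S" "S \<subseteq> {-1<..<1}" "p = s\<^sup>2 * (\<Prod>a\<in>S. [:-a, 1:]) * r"
      "\<forall>x\<in>{-1<..<1}. poly r x \<noteq> 0"
    using poly_odd_root_decomposition[OF \<open>p \<noteq> 0\<close>, of "{-1<..<1}"] by blast
  define q where "q = (\<Prod>a\<in>S. [:-a, 1:])"
  have q0: "q \<noteq> 0" unfolding q_def using d(1) by simp
  have degq: "degree q = card S"
    unfolding q_def by (subst degree_prod_eq_sum_degree) auto
  have "degree p \<le> card S"
  proof (rule ccontr)
    assume "\<not> degree p \<le> card S"
    then have int: "((\<lambda>x. poly p x * poly q x * jacobi_weight \<alpha> \<beta> x) has_integral 0) {-1..1}"
      using orth degq by (simp add: jacobi_orthogonal_def)
    have sgn: "(\<forall>x\<in>{-1<..<1}. poly r x > 0) \<or> (\<forall>x\<in>{-1<..<1}. poly r x < 0)"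
    proof (rule ccontr)
      assume "\<not> ?thesis"
      then obtain x y where xy: "x \<in> {-1<..<1}" "y \<in> {-1<..<1}" "poly r x < 0" "poly r y > 0"
        using d(4) by (metis linorder_neqE_linordered_idom)
      have "\<exists>z. z \<in> {-1<..<1} \<and> poly r z = 0"
      proof (cases x y rule: linorder_cases)
        case less
        then obtain z where "x < z" "z < y" "poly r z = 0" using poly_IVT_pos xy by blast
        then show ?thesis using xy by (intro exI[of _ z]) auto
      next
        case greater
        then obtain z where "y < z" "z < x" "poly r z = 0" using poly_IVT_neg xy by blast
        then show ?thesis using xy by (intro exI[of _ z]) auto
      qed (use xy in auto)
      with d(4) show False by blast
    qed
    \<comment> \<open>\<open>e\<close> is the sign of \<open>r\<close> on \<open>(-1, 1)\<close>.\<close>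
    define e :: real where "e = (if \<forall>x\<in>{-1<..<1}. poly r x > 0 then 1 else -1)"
    have e: "e * poly r x \<ge> 0" if "-1 < x" "x < 1" for x
      using sgn that by (auto simp: e_def intro: less_imp_le)
    have "e \<noteq> 0" by (simp add: e_def)
    have pq: "poly (smult e (p * q)) x = (poly s x * poly q x)\<^sup>2 * (e * poly r x)" for x
      unfolding d(3) q_def[symmetric] by (simp add: power2_eq_square ac_simps)
    have "smult e (p * q) = 0"
    proof (rule poly_eq_0_if_weighted_integral_eq_0)
      show "((\<lambda>x. poly (smult e (p * q)) x * jacobi_weight \<alpha> \<beta> x) has_integral 0) {-1..1}"
        using has_integral_mult_right[OF int, of e] by (simp add: ac_simps)
      show "poly (smult e (p * q)) x \<ge> 0" if "-1 < x" "x < 1" for x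
        unfolding pq by (rule mult_nonneg_nonneg[OF zero_le_power2 e[OF that]])
    qed
    with \<open>e \<noteq> 0\<close> q0 \<open>p \<noteq> 0\<close> show False by simp
  qed
  moreover have "S \<subseteq> ?Z"
  proof
    fix a assume "a \<in> S"
    then have "poly (\<Prod>a\<in>S. [:-a, 1:]) a = 0" using d(1) by (auto simp: poly_prod)
    then have "poly p a = 0" unfolding d(3) by simp
    then show "a \<in> ?Z" using \<open>a \<in> S\<close> d(2) by auto
  qed
  then have "card S \<le> card ?Z"
    by (intro card_mono) (auto intro: finite_subset[OF _ fin])
  ultimately show ?thesis using le by linarith
qed

definition jacobi_angles :: "real \<Rightarrow> real \<Rightarrow> nat \<Rightarrow> real set" where
  "jacobi_angles \<alpha> \<beta> n = {\<theta>. 0 < \<theta> \<and> \<theta> < pi \<and> poly (jacobi_poly \<alpha> \<beta> n) (cos \<theta>) = 0}"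

lemma jacobi_angles_card:
  assumes \<alpha>: "\<alpha> > -1" and \<beta>: "\<beta> > -1"
  shows "finite (jacobi_angles \<alpha> \<beta> n)" "card (jacobi_angles \<alpha> \<beta> n) = n"
proof -
  let ?p = "jacobi_poly \<alpha> \<beta> n"
  let ?Z = "{x. -1 < x \<and> x < 1 \<and> poly ?p x = 0}"
  have inj: "inj_on cos (jacobi_angles \<alpha> \<beta> n)"
    by (rule inj_onI, rule cos_inj_pi) (auto simp: jacobi_angles_def)
  have img: "cos ` jacobi_angles \<alpha> \<beta> n = ?Z"
  proof (intro equalityI subsetI)
    fix x assume "x \<in> cos ` jacobi_angles \<alpha> \<beta> n"
    then show "x \<in> ?Z"
      using cos_monotone_0_pi[of 0] cos_monotone_0_pi[of _ pi]
      by (force simp: jacobi_angles_def)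
  next
    fix x assume "x \<in> ?Z"
    then have "x = cos (arccos x)" "arccos x \<in> jacobi_angles \<alpha> \<beta> n"
      using arccos_lt_bounded[of x] by (auto simp: jacobi_angles_def)
    then show "x \<in> cos ` jacobi_angles \<alpha> \<beta> n" by blast
  qed
  have "finite {x. poly ?p x = 0}" by (intro poly_roots_finite jacobi_poly[OF \<alpha> \<beta>])
  then have "finite ?Z" by (rule rev_finite_subset) auto
  then show "finite (jacobi_angles \<alpha> \<beta> n)" using inj img finite_image_iff by metis
  have "card ?Z = n"
    using jacobi_orthogonal_card_roots[OF jacobi_eigenpolynomial_orthogonal[OF \<alpha> \<beta>], of ?p]
      jacobi_poly[OF \<alpha> \<beta>] by simp
  then show "card (jacobi_angles \<alpha> \<beta> n) = n" using card_image[OF inj] img by simp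
qed

lemma jacobi_theta_nth:
  "jacobi_theta \<alpha> \<beta> n k = sorted_list_of_set (jacobi_angles \<alpha> \<beta> n) ! (k - 1)"
  by (simp add: jacobi_theta_def jacobi_angles_def)

lemma jacobi_theta_in_angles:
  assumes \<alpha>: "\<alpha> > -1" and \<beta>: "\<beta> > -1" and "1 \<le> k" "k \<le> n"
  shows "jacobi_theta \<alpha> \<beta> n k \<in> jacobi_angles \<alpha> \<beta> n"
  using jacobi_angles_card[OF \<alpha> \<beta>, of n] assms
    nth_mem[of "k - 1" "sorted_list_of_set (jacobi_angles \<alpha> \<beta> n)"]
  by (simp add: jacobi_theta_nth)

lemma jacobi_theta_strict_mono:
  assumes \<alpha>: "\<alpha> > -1" and \<beta>: "\<beta> > -1" and "1 \<le> j" "j < k" "k \<le> n"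
  shows "jacobi_theta \<alpha> \<beta> n j < jacobi_theta \<alpha> \<beta> n k"
  using jacobi_angles_card[OF \<alpha> \<beta>, of n] assms
    sorted_wrt_nth_less[OF strict_sorted_list_of_set[of "jacobi_angles \<alpha> \<beta> n"], of "j - 1" "k - 1"]
  by (simp add: jacobi_theta_nth)

lemma jacobi_angles_obtain_index:
  assumes \<alpha>: "\<alpha> > -1" and \<beta>: "\<beta> > -1"
    and "t \<in> jacobi_angles \<alpha> \<beta> n"
  obtains k where "1 \<le> k" "k \<le> n" "t = jacobi_theta \<alpha> \<beta> n k"
proof -
  let ?xs = "sorted_list_of_set (jacobi_angles \<alpha> \<beta> n)"
  have "t \<in> set ?xs"
    using assms jacobi_angles_card[OF \<alpha> \<beta>] by simp
  then obtain i where "i < length ?xs" "t = ?xs ! i"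
    unfolding in_set_conv_nth by blast
  moreover have "length ?xs = n" using jacobi_angles_card[OF \<alpha> \<beta>, of n] by simp
  ultimately have "i < n" "t = ?xs ! i" by simp_all
  then show ?thesis using that[of "Suc i"] by (simp add: jacobi_theta_nth)
qed

lemma jacobi_theta_less_iff:
  assumes "\<alpha> > -1" "\<beta> > -1" "1 \<le> j" "j \<le> n" "1 \<le> k" "k \<le> n"
  shows "jacobi_theta \<alpha> \<beta> n j < jacobi_theta \<alpha> \<beta> n k \<longleftrightarrow> j < k"
  using jacobi_theta_strict_mono[of \<alpha> \<beta> j k n] jacobi_theta_strict_mono[of \<alpha> \<beta> k j n] assms
  by (cases j k rule: linorder_cases) auto

lemma jacobi_theta_gap:
  assumes \<alpha>: "\<alpha> > -1" and \<beta>: "\<beta> > -1" and "1 \<le> k" "k < n"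
    and "jacobi_theta \<alpha> \<beta> n k < t" "t < jacobi_theta \<alpha> \<beta> n (k + 1)"
  shows "t \<notin> jacobi_angles \<alpha> \<beta> n"
proof
  assume "t \<in> jacobi_angles \<alpha> \<beta> n"
  then obtain j where "1 \<le> j" "j \<le> n" "t = jacobi_theta \<alpha> \<beta> n j"
    by (rule jacobi_angles_obtain_index[OF \<alpha> \<beta>])
  then show False using assms by (auto simp: jacobi_theta_less_iff)
qed

section \<open>Sturm comparison\<close>

lemma nonvanishing_obtain_sign:
  fixes f :: "real \<Rightarrow> real"
  assumes cont: "\<And>t. t \<in> {a<..<b} \<Longrightarrow> isCont f t"
    and nz: "\<And>t. t \<in> {a<..<b} \<Longrightarrow> f t \<noteq> 0"
  obtains e :: real where "e \<noteq> 0" "\<And>t. t \<in> {a<..<b} \<Longrightarrow> e * f t > 0"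
proof -
  have "connected (f ` {a<..<b})"
    by (intro connected_continuous_image continuous_at_imp_continuous_on) (use cont in auto)
  moreover have "0 \<notin> f ` {a<..<b}" using nz by auto
  ultimately have "(\<forall>t\<in>{a<..<b}. f t > 0) \<or> (\<forall>t\<in>{a<..<b}. f t < 0)"
    unfolding connected_iff_interval using nz
    by (meson image_eqI linorder_neqE_linordered_idom order_less_imp_le)
  then show ?thesis
  proof
    assume "\<forall>t\<in>{a<..<b}. f t > 0"
    then show ?thesis by (intro that[of 1]) auto
  next
    assume "\<forall>t\<in>{a<..<b}. f t < 0"
    then show ?thesis by (intro that[of "-1"]) auto
  qed
qed

lemma DERIV_nonneg_at_left_zero:
  fixes v :: "real \<Rightarrow> real"
  assumes "(v has_real_derivative d) (at a)" "v a = 0" "a < b" "\<And>t. t \<in> {a<..<b} \<Longrightarrow> v t > 0"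
  shows "d \<ge> 0"
proof (rule ccontr)
  assume "\<not> d \<ge> 0"
  then obtain e where e: "e > 0" "\<And>h. 0 < h \<Longrightarrow> h < e \<Longrightarrow> v (a + h) < v a"
    using DERIV_neg_dec_right[OF assms(1)] by auto
  define h where "h = min e (b - a) / 2"
  have "0 < h" "h < e" "a + h < b" using e(1) \<open>a < b\<close> by (auto simp: h_def min_def field_simps)
  then show False using e(2)[of h] assms(4)[of "a + h"] assms(2) by auto
qed

lemma DERIV_nonpos_at_right_zero:
  fixes v :: "real \<Rightarrow> real"
  assumes "(v has_real_derivative d) (at b)" "v b = 0" "a < b" "\<And>t. t \<in> {a<..<b} \<Longrightarrow> v t > 0"
  shows "d \<le> 0"
proof (rule ccontr)
  assume "\<not> d \<le> 0"
  then obtain e where e: "e > 0" "\<And>h. 0 < h \<Longrightarrow> h < e \<Longrightarrow> v (b - h) < v b"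
    using DERIV_pos_inc_left[OF assms(1)] by auto
  define h where "h = min e (b - a) / 2"
  have "0 < h" "h < e" "a < b - h" using e(1) \<open>a < b\<close> by (auto simp: h_def min_def field_simps)
  then show False using e(2)[of h] assms(4)[of "b - h"] assms(2) by auto
qed

text \<open>
  If neither \<open>u\<close> nor \<open>v\<close> vanished in between, the Wronskian \<open>u v' - u' v\<close>, with derivative
  \<open>(F - G) u v\<close>, would be strictly monotone, whereas its boundary values force the opposite
  direction. The left endpoint is either a zero of \<open>v\<close> up to which everything extends smoothly, or a
  possibly singular point where the Wronskian tends to \<open>0\<close>.
\<close>

lemma sturm_comparison:
  fixes u v u' v' F G :: "real \<Rightarrow> real"
  assumes ab: "a < b"
    and u: "\<And>t. t \<in> {a<..b} \<Longrightarrow> (u has_real_derivative u' t) (at t)"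
    and u': "\<And>t. t \<in> {a<..b} \<Longrightarrow> (u' has_real_derivative - F t * u t) (at t)"
    and v: "\<And>t. t \<in> {a<..b} \<Longrightarrow> (v has_real_derivative v' t) (at t)"
    and v': "\<And>t. t \<in> {a<..b} \<Longrightarrow> (v' has_real_derivative - G t * v t) (at t)"
    and GF: "\<And>t. t \<in> {a<..<b} \<Longrightarrow> G t < F t"
    and vb: "v b = 0"
    and vnz: "\<And>t. t \<in> {a<..<b} \<Longrightarrow> v t \<noteq> 0"
    and left: "((\<lambda>t. u t * v' t - u' t * v t) \<longlongrightarrow> 0) (at_right a)
      \<or> v a = 0 \<and> isCont u a \<and> isCont u' a \<and> (v has_real_derivative v' a) (at a) \<and> isCont v' a"
  shows "\<exists>t\<in>{a<..<b}. u t = 0"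
proof (rule ccontr)
  assume "\<not> ?thesis"
  then have unz: "u t \<noteq> 0" if "t \<in> {a<..<b}" for t using that by auto
  have cu: "isCont u t" "isCont u' t" "isCont v t" "isCont v' t" if "t \<in> {a<..b}" for t
    using u[OF that] u'[OF that] v[OF that] v'[OF that] DERIV_isCont by blast+
  obtain e where e: "e \<noteq> 0" "\<And>t. t \<in> {a<..<b} \<Longrightarrow> e * u t > 0"
    using nonvanishing_obtain_sign[of a b u] cu(1) unz by auto
  obtain d where d: "d \<noteq> 0" "\<And>t. t \<in> {a<..<b} \<Longrightarrow> d * v t > 0"
    using nonvanishing_obtain_sign[of a b v] cu(3) vnz by auto
  \<comment> \<open>The signs \<open>e\<close> and \<open>d\<close> make both functions positive, so that \<open>W\<close> increases.\<close>
  define W where "W t = (e * d) * (u t * v' t - u' t * v t)" for t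
  have W': "(W has_real_derivative (F t - G t) * ((e * u t) * (d * v t))) (at t)"
    if "t \<in> {a<..b}" for t
    unfolding W_def
    by (rule DERIV_cong[OF DERIV_cmult[OF DERIV_diff[OF
          DERIV_mult[OF u[OF that] v'[OF that]] DERIV_mult[OF u'[OF that] v[OF that]]]]])
      (simp add: algebra_simps)
  have W_less: "W x < W y" if "a < x" "x < y" "y < b" for x y
  proof (rule DERIV_pos_imp_increasing[OF \<open>x < y\<close>])
    fix t assume t: "x \<le> t" "t \<le> y"
    with that have "t \<in> {a<..<b}" by auto
    then have "(F t - G t) * ((e * u t) * (d * v t)) > 0"
      using mult_pos_pos[OF _ mult_pos_pos[OF e(2) d(2)], of "F t - G t" t t] GF by simp
    moreover have "t \<in> {a<..b}" using t that by auto
    ultimately show "\<exists>z. (W has_real_derivative z) (at t) \<and> 0 < z" using W' by blast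
  qed
  have lim_a: "\<exists>L\<ge>0. (W \<longlongrightarrow> L) (at_right a)"
    using left
  proof
    assume "((\<lambda>t. u t * v' t - u' t * v t) \<longlongrightarrow> 0) (at_right a)"
    then have "(W \<longlongrightarrow> (e * d) * 0) (at_right a)" unfolding W_def by (intro tendsto_mult tendsto_const)
    then show ?thesis by auto
  next
    assume a: "v a = 0 \<and> isCont u a \<and> isCont u' a \<and> (v has_real_derivative v' a) (at a) \<and> isCont v' a"
    then have "isCont v a" using DERIV_isCont by blast
    have "isCont W a" unfolding W_def using a \<open>isCont v a\<close> by (intro continuous_intros) auto
    then have W: "(W \<longlongrightarrow> W a) (at_right a)"
      by (simp add: continuous_within filterlim_at_split isCont_def)
    have "((\<lambda>t. e * u t) \<longlongrightarrow> e * u a) (at_right a)"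
      using a by (intro tendsto_mult tendsto_const) (simp add: filterlim_at_split isCont_def)
    moreover have "\<forall>\<^sub>F t in at_right a. 0 \<le> e * u t"
      using eventually_at_right_real[OF ab] by eventually_elim (use e in \<open>force intro: less_imp_le\<close>)
    ultimately have "e * u a \<ge> 0" by (rule tendsto_lowerbound) simp
    moreover have "d * v' a \<ge> 0"
      by (rule DERIV_nonneg_at_left_zero[of "\<lambda>t. d * v t" _ a b])
        (use a ab d in \<open>auto intro!: DERIV_cmult\<close>)
    ultimately have "(e * u a) * (d * v' a) \<ge> 0" by (rule mult_nonneg_nonneg)
    then have "W a \<ge> 0" using a by (simp add: W_def ac_simps)
    with W show ?thesis by blast
  qed
  then obtain L where L: "L \<ge> 0" "(W \<longlongrightarrow> L) (at_right a)" by blast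
  have b: "b \<in> {a<..b}" using ab by simp
  have "isCont W b" using W'[OF b] DERIV_isCont by blast
  then have lim_b: "(W \<longlongrightarrow> W b) (at_left b)" by (simp add: filterlim_at_split isCont_def)
  have Wb: "W b \<le> 0"
  proof -
    have "((\<lambda>t. e * u t) \<longlongrightarrow> e * u b) (at_left b)"
      using cu(1)[OF b] by (intro tendsto_mult tendsto_const) (simp add: filterlim_at_split isCont_def)
    moreover have "\<forall>\<^sub>F t in at_left b. 0 \<le> e * u t"
      using eventually_at_left_real[OF ab] by eventually_elim (use e in \<open>force intro: less_imp_le\<close>)
    ultimately have "e * u b \<ge> 0" by (rule tendsto_lowerbound) simp
    moreover have "d * v' b \<le> 0"
      by (rule DERIV_nonpos_at_right_zero[of "\<lambda>t. d * v t" _ b a])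
        (use v[OF b] vb ab d in \<open>auto intro!: DERIV_cmult\<close>)
    ultimately have "(e * u b) * (d * v' b) \<le> 0" by (rule mult_nonneg_nonpos)
    then show ?thesis using vb by (simp add: W_def ac_simps)
  qed
  define x y where "x = (2 * a + b) / 3" and "y = (a + 2 * b) / 3"
  have xy: "a < x" "x < y" "y < b" using ab by (auto simp: x_def y_def field_simps)
  have "\<forall>\<^sub>F t in at_right a. W t \<le> W x"
    using eventually_at_right_real[OF xy(1)]
    by eventually_elim (use W_less xy in \<open>force intro: less_imp_le\<close>)
  with L(2) have "L \<le> W x" by (rule tendsto_upperbound) simp
  moreover have "\<forall>\<^sub>F t in at_left b. W y \<le> W t"
    using eventually_at_left_real[OF xy(3)]
    by eventually_elim (use W_less xy in \<open>force intro: less_imp_le\<close>)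
  with lim_b have "W y \<le> W b" by (rule tendsto_lowerbound) simp
  ultimately show False using L(1) Wb W_less[OF xy] by linarith
qed

section \<open>The Liouville normal form of the Jacobi equation\<close>

text \<open>
  The factor that removes the first-order term from Jacobi's equation in the variable \<open>t\<close> with
  \<open>x = cos t\<close>. Its logarithmic derivative is \<open>liouville_log_deriv\<close>.
\<close>

definition liouville_weight :: "real \<Rightarrow> real \<Rightarrow> real \<Rightarrow> real" where
  "liouville_weight \<alpha> \<beta> t = sin (t / 2) powr (\<alpha> + 1/2) * cos (t / 2) powr (\<beta> + 1/2)"

definition liouville_log_deriv :: "real \<Rightarrow> real \<Rightarrow> real \<Rightarrow> real" where
  "liouville_log_deriv \<alpha> \<beta> t =
     ((\<alpha> + 1/2) * (cos (t / 2) / sin (t / 2)) - (\<beta> + 1/2) * (sin (t / 2) / cos (t / 2))) / 2"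

definition liouville :: "real \<Rightarrow> real \<Rightarrow> real poly \<Rightarrow> real \<Rightarrow> real" where
  "liouville \<alpha> \<beta> p t = liouville_weight \<alpha> \<beta> t * poly p (cos t)"

definition liouville_deriv :: "real \<Rightarrow> real \<Rightarrow> real poly \<Rightarrow> real \<Rightarrow> real" where
  "liouville_deriv \<alpha> \<beta> p t = liouville_weight \<alpha> \<beta> t *
     (liouville_log_deriv \<alpha> \<beta> t * poly p (cos t) - sin t * poly (pderiv p) (cos t))"

definition liouville_potential :: "real \<Rightarrow> real \<Rightarrow> nat \<Rightarrow> real \<Rightarrow> real" where
  "liouville_potential \<alpha> \<beta> n t = (real n + (\<alpha> + \<beta> + 1) / 2)\<^sup>2
     + ((1/4 - \<alpha>\<^sup>2) / (4 * (sin (t / 2))\<^sup>2) + (1/4 - \<beta>\<^sup>2) / (4 * (cos (t / 2))\<^sup>2))"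

lemma half_angle_pos:
  fixes t :: real
  assumes "0 < t" "t < pi"
  shows "sin (t / 2) > 0" "cos (t / 2) > 0"
  using assms by (auto intro!: sin_gt_zero cos_gt_zero)

lemma liouville_eq_0_iff:
  assumes "0 < t" "t < pi"
  shows "liouville \<alpha> \<beta> p t = 0 \<longleftrightarrow> poly p (cos t) = 0"
  using half_angle_pos[OF assms] by (simp add: liouville_def liouville_weight_def)

lemma DERIV_liouville_weight:
  assumes "0 < t" "t < pi"
  shows "(liouville_weight \<alpha> \<beta> has_real_derivative
    liouville_weight \<alpha> \<beta> t * liouville_log_deriv \<alpha> \<beta> t) (at t)"
proof -
  note sc = half_angle_pos[OF assms]
  have 1: "((\<lambda>t. sin (t / 2) powr a) has_real_derivative
      a * sin (t / 2) powr a * (cos (t / 2) / sin (t / 2)) / 2) (at t)" for a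
    using sc by (auto intro!: derivative_eq_intros simp: powr_diff)
  have 2: "((\<lambda>t. cos (t / 2) powr a) has_real_derivative
      - a * cos (t / 2) powr a * (sin (t / 2) / cos (t / 2)) / 2) (at t)" for a
    using sc by (auto intro!: derivative_eq_intros simp: powr_diff)
  have ring: "a * S * X / 2 * C + - b * C * Y / 2 * S = S * C * ((a * X - b * Y) / 2)"
    for a b S C X Y :: real
    by (simp add: field_simps)
  show ?thesis unfolding liouville_weight_def liouville_log_deriv_def
    by (rule DERIV_cong[OF DERIV_mult[OF 1 2]]) (rule ring)
qed

lemma DERIV_liouville_log_deriv:
  assumes "0 < t" "t < pi"
  shows "(liouville_log_deriv \<alpha> \<beta> has_real_derivative
    - ((\<alpha> + 1/2) / (sin (t / 2))\<^sup>2 + (\<beta> + 1/2) / (cos (t / 2))\<^sup>2) / 4) (at t)"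
proof -
  note sc = half_angle_pos[OF assms]
  have 1: "((\<lambda>t. cos (t / 2) / sin (t / 2)) has_real_derivative - (1 / (sin (t / 2))\<^sup>2) / 2) (at t)"
  proof (rule DERIV_cong)
    show "((\<lambda>t. cos (t / 2) / sin (t / 2)) has_real_derivative
        ((- sin (t / 2) * (1 / 2)) * sin (t / 2) - cos (t / 2) * (cos (t / 2) * (1 / 2)))
        / (sin (t / 2) * sin (t / 2))) (at t)"
      using sc by (auto intro!: derivative_eq_intros)
    have "- sin (t / 2) * (1 / 2) * sin (t / 2) - cos (t / 2) * (cos (t / 2) * (1 / 2))
        = - (1 / 2) * ((sin (t / 2))\<^sup>2 + (cos (t / 2))\<^sup>2)"
      by (simp add: algebra_simps power2_eq_square del: sin_cos_squared_add sin_cos_squared_add2 sin_cos_squared_add3)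
    also have "\<dots> = - (1 / 2)" by simp
    finally show "(- sin (t / 2) * (1 / 2) * sin (t / 2) - cos (t / 2) * (cos (t / 2) * (1 / 2)))
        / (sin (t / 2) * sin (t / 2)) = - (1 / (sin (t / 2))\<^sup>2) / 2"
      by (simp add: power2_eq_square)
  qed
  have 2: "((\<lambda>t. sin (t / 2) / cos (t / 2)) has_real_derivative (1 / (cos (t / 2))\<^sup>2) / 2) (at t)"
  proof (rule DERIV_cong)
    show "((\<lambda>t. sin (t / 2) / cos (t / 2)) has_real_derivative
        ((cos (t / 2) * (1 / 2)) * cos (t / 2) - sin (t / 2) * (- sin (t / 2) * (1 / 2)))
        / (cos (t / 2) * cos (t / 2))) (at t)"
      using sc by (auto intro!: derivative_eq_intros)
    have "cos (t / 2) * (1 / 2) * cos (t / 2) - sin (t / 2) * (- sin (t / 2) * (1 / 2))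
        = (1 / 2) * ((sin (t / 2))\<^sup>2 + (cos (t / 2))\<^sup>2)"
      by (simp add: algebra_simps power2_eq_square del: sin_cos_squared_add sin_cos_squared_add2 sin_cos_squared_add3)
    also have "\<dots> = 1 / 2" by simp
    finally have eq: "cos (t / 2) * (1 / 2) * cos (t / 2) - sin (t / 2) * (- sin (t / 2) * (1 / 2))
      = 1 / 2" .
    show "(cos (t / 2) * (1 / 2) * cos (t / 2) - sin (t / 2) * (- sin (t / 2) * (1 / 2)))
        / (cos (t / 2) * cos (t / 2)) = (1 / (cos (t / 2))\<^sup>2) / 2"
      unfolding eq by (simp add: power2_eq_square)
  qed
  have ring: "(a * (- (1 / S) / 2) - b * (1 / C / 2)) / 2 = - (a / S + b / C) / 4"
    for a b S C :: real
    by (cases "S = 0"; cases "C = 0") (simp_all add: field_simps)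
  show ?thesis unfolding liouville_log_deriv_def
    by (rule DERIV_cong[OF DERIV_cdivide[OF DERIV_diff[OF DERIV_cmult[OF 1] DERIV_cmult[OF 2]]]])
      (rule ring)
qed

text \<open>
  The right-hand side is, up to the contribution \<open>cos t\<close> of the second derivative of \<open>p (cos t)\<close>, the
  negative of the first-order coefficient of the Jacobi operator at \<open>cos t\<close>: this is why the
  first-order term disappears.
\<close>

lemma liouville_log_deriv_times_sin:
  assumes "0 < t" "t < pi"
  shows "2 * liouville_log_deriv \<alpha> \<beta> t * sin t = \<alpha> - \<beta> + (\<alpha> + \<beta> + 1) * cos t"
proof -
  define s c where "s = sin (t / 2)" and "c = cos (t / 2)"
  have sc: "s > 0" "c > 0" "s\<^sup>2 + c\<^sup>2 = 1" using half_angle_pos[OF assms] by (auto simp: s_def c_def)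
  have st: "sin t = 2 * s * c" using sin_double[of "t / 2"] by (simp add: s_def c_def)
  have ct: "cos t = c\<^sup>2 - s\<^sup>2" using cos_double[of "t / 2"] by (simp add: s_def c_def)
  have "2 * liouville_log_deriv \<alpha> \<beta> t * sin t = (2 * \<alpha> + 1) * c\<^sup>2 - (2 * \<beta> + 1) * s\<^sup>2"
    using sc(1,2) unfolding liouville_log_deriv_def s_def[symmetric] c_def[symmetric] st
    by (simp add: field_simps power2_eq_square)
  also have "\<dots> = (\<alpha> - \<beta>) * (s\<^sup>2 + c\<^sup>2) + (\<alpha> + \<beta> + 1) * (c\<^sup>2 - s\<^sup>2)"
    by (simp add: algebra_simps)
  finally show ?thesis by (simp add: sc(3) ct)
qed

text \<open>
  With \<open>h\<close> the logarithmic derivative of the weight \<open>w\<close>, the left-hand side is \<open>h' + h\<^sup>2 = w'' / w\<close>,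
  the amount by which passing to the normal form shifts the eigenvalue.
\<close>

lemma liouville_potential_riccati:
  assumes "0 < t" "t < pi"
  shows "- ((\<alpha> + 1/2) / (sin (t / 2))\<^sup>2 + (\<beta> + 1/2) / (cos (t / 2))\<^sup>2) / 4
     + (liouville_log_deriv \<alpha> \<beta> t)\<^sup>2 = jacobi_eigenvalue \<alpha> \<beta> n - liouville_potential \<alpha> \<beta> n t"
proof -
  define s c where "s = sin (t / 2)" and "c = cos (t / 2)"
  have sc: "s > 0" "c > 0" "s\<^sup>2 + c\<^sup>2 = 1" using half_angle_pos[OF assms] by (auto simp: s_def c_def)
  define a b where "a = \<alpha> + 1/2" and "b = \<beta> + 1/2"
  have "(liouville_log_deriv \<alpha> \<beta> t)\<^sup>2 = (a\<^sup>2 * (c\<^sup>2 / s\<^sup>2) - 2 * a * b + b\<^sup>2 * (s\<^sup>2 / c\<^sup>2)) / 4"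
    using sc(1,2)
    unfolding liouville_log_deriv_def s_def[symmetric] c_def[symmetric] a_def[symmetric] b_def[symmetric]
    by (simp add: field_simps power2_eq_square)
  also have "c\<^sup>2 / s\<^sup>2 = 1 / s\<^sup>2 - 1"
    using sc by (simp add: field_simps)
  also have "s\<^sup>2 / c\<^sup>2 = 1 / c\<^sup>2 - 1"
    using sc by (simp add: field_simps)
  finally show ?thesis
    unfolding liouville_potential_def jacobi_eigenvalue_def s_def[symmetric] c_def[symmetric]
    by (simp add: a_def b_def diff_divide_distrib add_divide_distrib power2_eq_square algebra_simps)
qed

lemma DERIV_liouville:
  assumes "0 < t" "t < pi"
  shows "(liouville \<alpha> \<beta> p has_real_derivative liouville_deriv \<alpha> \<beta> p t) (at t)"
proof -
  have "((\<lambda>t. poly p (cos t)) has_real_derivative - sin t * poly (pderiv p) (cos t)) (at t)"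
    by (auto intro!: derivative_eq_intros)
  from DERIV_mult[OF DERIV_liouville_weight[OF assms] this] show ?thesis
    unfolding liouville_def liouville_deriv_def by (rule DERIV_cong) (simp add: algebra_simps)
qed

text \<open>
  This is Jacobi's equation in Liouville normal form, \<open>u'' = - Q u\<close>.
\<close>

lemma DERIV_liouville_deriv:
  assumes "0 < t" "t < pi"
    and p: "jacobi_op \<alpha> \<beta> p = smult (- jacobi_eigenvalue \<alpha> \<beta> n) p"
  shows "(liouville_deriv \<alpha> \<beta> p has_real_derivative
    - liouville_potential \<alpha> \<beta> n t * liouville \<alpha> \<beta> p t) (at t)"
proof -
  let ?h = "liouville_log_deriv \<alpha> \<beta> t" and ?w = "liouville_weight \<alpha> \<beta> t"
  let ?h' = "- ((\<alpha> + 1/2) / (sin (t / 2))\<^sup>2 + (\<beta> + 1/2) / (cos (t / 2))\<^sup>2) / 4"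
  let ?y = "poly p (cos t)" and ?y1 = "poly (pderiv p) (cos t)"
  let ?y2 = "poly (pderiv (pderiv p)) (cos t)"
  have y: "((\<lambda>t. poly p (cos t)) has_real_derivative - sin t * ?y1) (at t)"
    by (auto intro!: derivative_eq_intros)
  have y1: "((\<lambda>t. sin t * poly (pderiv p) (cos t)) has_real_derivative
      cos t * ?y1 - (sin t)\<^sup>2 * ?y2) (at t)"
    by (auto intro!: derivative_eq_intros simp: power2_eq_square)
  have ode: "(sin t)\<^sup>2 * ?y2 - cos t * ?y1 - 2 * ?h * sin t * ?y1 = - jacobi_eigenvalue \<alpha> \<beta> n * ?y"
  proof -
    have "poly (jacobi_op \<alpha> \<beta> p) (cos t) = - jacobi_eigenvalue \<alpha> \<beta> n * ?y" by (simp add: p)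
    then show ?thesis
      unfolding poly_jacobi_op liouville_log_deriv_times_sin[OF assms(1,2)] sin_squared_eq
      by (simp add: algebra_simps)
  qed
  have "(liouville_deriv \<alpha> \<beta> p has_real_derivative
      ?w * ?h * (?h * ?y - sin t * ?y1)
      + (?h' * ?y + (- sin t * ?y1) * ?h - (cos t * ?y1 - (sin t)\<^sup>2 * ?y2)) * ?w) (at t)"
    unfolding liouville_deriv_def
    by (rule DERIV_mult[OF DERIV_liouville_weight[OF assms(1,2)]
        DERIV_diff[OF DERIV_mult[OF DERIV_liouville_log_deriv[OF assms(1,2)] y] y1]])
  moreover have "?w * ?h * (?h * ?y - sin t * ?y1)
      + (?h' * ?y + (- sin t * ?y1) * ?h - (cos t * ?y1 - (sin t)\<^sup>2 * ?y2)) * ?w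
      = ?w * ((?h' + ?h\<^sup>2) * ?y
        + ((sin t)\<^sup>2 * ?y2 - cos t * ?y1 - 2 * ?h * sin t * ?y1))"
    by (simp only: algebra_simps power2_eq_square mult_2 mult_2_right)
  moreover have "\<dots> = - liouville_potential \<alpha> \<beta> n t * liouville \<alpha> \<beta> p t"
    unfolding ode liouville_potential_riccati[OF assms(1,2), of \<alpha> \<beta> n] liouville_def
    by (simp add: algebra_simps)
  ultimately show ?thesis by simp
qed

text \<open>
  The pole \<open>(\<alpha> + 1/2) / t\<close> of the scaled logarithmic derivative does not depend on the scaling factor
  \<open>s\<close>, so that the difference of two of these functions is of order \<open>t\<close> at \<open>0\<close>.
\<close>

lemma liouville_log_deriv_scaled_limit:
  assumes "s > 0"
  shows "((\<lambda>t. (s * liouville_log_deriv \<alpha> \<beta> (s * t) - (\<alpha> + 1/2) / t) / t)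
     \<longlongrightarrow> - (\<alpha> + 1/2) * s\<^sup>2 / 12 - (\<beta> + 1/2) * s\<^sup>2 / 4) (at_right 0)"
proof -
  have 1: "((\<lambda>t. (s * (cos (s * t / 2) / sin (s * t / 2)) / 2 - 1 / t) / t) \<longlongrightarrow> - s\<^sup>2 / 12) (at_right 0)"
    using assms by real_asymp (simp add: field_simps power2_eq_square)
  have 2: "((\<lambda>t. s * (sin (s * t / 2) / cos (s * t / 2)) / 2 / t) \<longlongrightarrow> s\<^sup>2 / 4) (at_right 0)"
    using assms by real_asymp (simp add: power2_eq_square)
  have ring: "P * ((s * X / 2 - 1 / t) / t) - Q * (s * Y / 2 / t)
      = (s * ((P * X - Q * Y) / 2) - P / t) / t" for P Q X Y t :: real
    by (cases "t = 0") (simp_all add: field_simps)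
  have "((\<lambda>t. (\<alpha> + 1/2) * ((s * (cos (s * t / 2) / sin (s * t / 2)) / 2 - 1 / t) / t)
      - (\<beta> + 1/2) * (s * (sin (s * t / 2) / cos (s * t / 2)) / 2 / t))
      \<longlongrightarrow> (\<alpha> + 1/2) * (- s\<^sup>2 / 12) - (\<beta> + 1/2) * (s\<^sup>2 / 4)) (at_right 0)"
    by (intro tendsto_intros 1 2)
  from this[unfolded ring] show ?thesis
    unfolding liouville_log_deriv_def by (rule tendsto_eq_rhs) (simp add: algebra_simps)
qed

lemma liouville_weight_product_limit:
  assumes "\<alpha> > -1" "r > 0" "s > 0"
  shows "((\<lambda>t. liouville_weight \<alpha> \<beta> (r * t) * liouville_weight \<alpha> \<beta> (s * t) * t) \<longlongrightarrow> 0) (at_right 0)"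
proof -
  have lim: "((\<lambda>t. (sin (r * t / 2) / t) powr (\<alpha> + 1/2) * cos (r * t / 2) powr (\<beta> + 1/2))
      \<longlongrightarrow> (r / 2) powr (\<alpha> + 1/2)) (at_right 0)" if "r > 0" for r :: real
  proof -
    have "((\<lambda>t. sin (r * t / 2) / t) \<longlongrightarrow> r / 2) (at_right 0)" using that by real_asymp
    moreover have "((\<lambda>t. cos (r * t / 2)) \<longlongrightarrow> 1) (at_right 0)" using that by real_asymp
    ultimately have "((\<lambda>t. (sin (r * t / 2) / t) powr (\<alpha> + 1/2) * cos (r * t / 2) powr (\<beta> + 1/2))
      \<longlongrightarrow> (r / 2) powr (\<alpha> + 1/2) * 1 powr (\<beta> + 1/2)) (at_right 0)"
      using that by (intro tendsto_mult tendsto_powr tendsto_const) auto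
    then show ?thesis by simp
  qed
  have "((\<lambda>t::real. t powr (2 * \<alpha> + 2)) \<longlongrightarrow> 0) (at_right 0)"
    using assms(1) by (intro tendsto_zero_powrI[of _ _ _ "2 * \<alpha> + 2"]) (auto intro: tendsto_ident_at eventually_mono[OF eventually_at_right_less])
  from tendsto_mult[OF tendsto_mult[OF lim[OF \<open>r > 0\<close>] lim[OF \<open>s > 0\<close>]] this]
  have L: "((\<lambda>t. (sin (r * t / 2) / t) powr (\<alpha> + 1/2) * cos (r * t / 2) powr (\<beta> + 1/2)
     * ((sin (s * t / 2) / t) powr (\<alpha> + 1/2) * cos (s * t / 2) powr (\<beta> + 1/2))
     * t powr (2 * \<alpha> + 2)) \<longlongrightarrow> 0) (at_right 0)"
    by simp
  have "\<forall>\<^sub>F t in at_right 0. t < min (pi / r) (pi / s)"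
    using assms by (intro eventually_at_rightI[of 0 "min (pi / r) (pi / s)"]) auto
  then have "\<forall>\<^sub>F t in at_right 0.
      (sin (r * t / 2) / t) powr (\<alpha> + 1/2) * cos (r * t / 2) powr (\<beta> + 1/2)
     * ((sin (s * t / 2) / t) powr (\<alpha> + 1/2) * cos (s * t / 2) powr (\<beta> + 1/2))
     * t powr (2 * \<alpha> + 2)
     = liouville_weight \<alpha> \<beta> (r * t) * liouville_weight \<alpha> \<beta> (s * t) * t"
    using eventually_at_right_less[of 0]
  proof eventually_elim
    case (elim t)
    have "0 < r * t" "r * t < pi" "0 < s * t" "s * t < pi"
      using elim assms by (auto simp: field_simps)
    then have "sin (r * t / 2) > 0" "sin (s * t / 2) > 0"
      using half_angle_pos by blast+
    moreover have "t powr (2 * \<alpha> + 2) = t powr (\<alpha> + 1/2) * t powr (\<alpha> + 1/2) * t"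
    proof -
      have "2 * \<alpha> + 2 = (\<alpha> + 1/2) + (\<alpha> + 1/2) + 1" by simp
      then show ?thesis using elim by (simp only: powr_add) simp
    qed
    ultimately show ?case
      using elim by (simp add: powr_divide liouville_weight_def)
  qed
  with L show ?thesis by (rule Lim_transform_eventually)
qed

text \<open>
  The product of the two weights is of order \<open>t powr (2 * \<alpha> + 1)\<close>, which may be unbounded. It is
  multiplied by a combination of order \<open>t\<close>, because the poles of the logarithmic derivatives cancel,
  and \<open>2 * \<alpha> + 2 > 0\<close>.
\<close>

lemma liouville_wronskian_limit:
  assumes \<alpha>: "\<alpha> > -1" and r: "r > 0" and s: "s > 0"
  shows "((\<lambda>t. liouville \<alpha> \<beta> p (r * t) * (s * liouville_deriv \<alpha> \<beta> q (s * t))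
     - r * liouville_deriv \<alpha> \<beta> p (r * t) * liouville \<alpha> \<beta> q (s * t)) \<longlongrightarrow> 0) (at_right 0)"
proof -
  define w where "w t = liouville_weight \<alpha> \<beta> (r * t) * liouville_weight \<alpha> \<beta> (s * t) * t" for t
  define K where "K s t = (s * liouville_log_deriv \<alpha> \<beta> (s * t) - (\<alpha> + 1/2) / t) / t" for s t
  define y where "y p s t = poly p (cos (s * t))" for p and s t :: real
  \<comment> \<open>The Wronskian divided by \<open>w\<close>; the pole \<open>(\<alpha> + 1/2) / t\<close> has cancelled in \<open>K s t - K r t\<close>.\<close>
  define E where "E t = y p r t * y q s t * (K s t - K r t)
      - s * (sin (s * t) / t) * y p r t * y (pderiv q) s t
      + r * (sin (r * t) / t) * y q s t * y (pderiv p) r t" for t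
  have sinlim: "((\<lambda>t. sin (s * t) / t) \<longlongrightarrow> s) (at_right 0)" if "s > 0" for s :: real
    using that by real_asymp
  have ylim: "(y p s \<longlongrightarrow> poly p 1) (at_right 0)" for p s
  proof -
    have "((\<lambda>t. poly p (cos (s * t))) \<longlongrightarrow> poly p (cos (s * 0))) (at_right 0)"
      by (intro tendsto_intros)
    then show ?thesis by (simp add: y_def[abs_def])
  qed
  have Klim: "\<exists>l. (K s \<longlongrightarrow> l) (at_right 0)" if "s > 0" for s
    unfolding K_def using liouville_log_deriv_scaled_limit[OF that] by blast
  obtain l m where "(K s \<longlongrightarrow> l) (at_right 0)" "(K r \<longlongrightarrow> m) (at_right 0)"
    using Klim r s by blast
  then have "(E \<longlongrightarrow> poly p 1 * poly q 1 * (l - m) - s * s * poly p 1 * poly (pderiv q) 1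
      + r * r * poly q 1 * poly (pderiv p) 1) (at_right 0)"
    unfolding E_def by (intro tendsto_intros ylim sinlim r s)
  then have "((\<lambda>t. w t * E t) \<longlongrightarrow> 0) (at_right 0)"
    using tendsto_mult[OF liouville_weight_product_limit[OF \<alpha> r s]] unfolding w_def by fastforce
  moreover have "\<forall>\<^sub>F t in at_right 0. w t * E t =
      liouville \<alpha> \<beta> p (r * t) * (s * liouville_deriv \<alpha> \<beta> q (s * t))
      - r * liouville_deriv \<alpha> \<beta> p (r * t) * liouville \<alpha> \<beta> q (s * t)"
    using eventually_at_right_less[of 0]
  proof eventually_elim
    case (elim t)
    then show ?case
      unfolding w_def E_def K_def y_def liouville_def liouville_deriv_def
      by (simp add: field_simps)
  qed
  ultimately show ?thesis by (rule Lim_transform_eventually)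
qed

section \<open>Monotonicity of the scaled zeros\<close>

lemma x_cot_x_antimono:
  fixes x y :: real
  assumes "0 < x" "x \<le> y" "y < pi / 2"
  shows "y * cos y / sin y \<le> x * cos x / sin x"
proof (rule DERIV_nonpos_imp_nonincreasing[OF \<open>x \<le> y\<close>])
  fix t assume "x \<le> t" "t \<le> y"
  then have t: "0 < t" "t < pi / 2" using assms by auto
  then have s: "sin t > 0" by (intro sin_gt_zero) auto
  have "((\<lambda>t. t * cos t / sin t) has_real_derivative
      ((cos t + t * (- sin t)) * sin t - t * cos t * cos t) / (sin t * sin t)) (at t)"
    using s by (auto intro!: derivative_eq_intros)
  also have "(cos t + t * (- sin t)) * sin t - t * cos t * cos t
      = cos t * sin t - t * ((sin t)\<^sup>2 + (cos t)\<^sup>2)"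
    by (simp add: algebra_simps power2_eq_square del: sin_cos_squared_add sin_cos_squared_add2 sin_cos_squared_add3)
  also have "\<dots> = cos t * sin t - t" by simp
  finally have "((\<lambda>t. t * cos t / sin t) has_real_derivative
      (cos t * sin t - t) / (sin t * sin t)) (at t)" .
  moreover have "sin (2 * t) \<le> 2 * t" using t by (intro sin_x_le_x) auto
  then have "sin t * cos t \<le> t" by (simp add: sin_double)
  then have "(cos t * sin t - t) / (sin t * sin t) \<le> 0"
    using s by (intro divide_nonpos_pos) (simp_all add: mult.commute)
  ultimately show "\<exists>z. ((\<lambda>t. t * cos t / sin t) has_real_derivative z) (at t) \<and> z \<le> 0"
    by blast
qed

lemma x_cos_x_le_sin_x:
  fixes x :: real
  assumes "0 \<le> x" "x \<le> pi"
  shows "x * cos x \<le> sin x"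
proof -
  have "sin 0 - 0 * cos 0 \<le> sin x - x * cos x"
  proof (rule DERIV_nonneg_imp_nondecreasing[OF \<open>0 \<le> x\<close>])
    fix t assume "0 \<le> t" "t \<le> x"
    then have "t * sin t \<ge> 0" using assms by (intro mult_nonneg_nonneg sin_ge_zero) auto
    moreover have "((\<lambda>t. sin t - t * cos t) has_real_derivative t * sin t) (at t)"
      by (auto intro!: derivative_eq_intros)
    ultimately show "\<exists>z. ((\<lambda>t. sin t - t * cos t) has_real_derivative z) (at t) \<and> 0 \<le> z"
      by blast
  qed
  then show ?thesis by simp
qed

lemma sin_x_over_x_antimono:
  fixes x y :: real
  assumes "0 < x" "x \<le> y" "y \<le> pi"
  shows "sin y / y \<le> sin x / x"
proof (rule DERIV_nonpos_imp_nonincreasing[OF \<open>x \<le> y\<close>])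
  fix t assume "x \<le> t" "t \<le> y"
  then have t: "0 < t" "t \<le> pi" using assms by auto
  have "((\<lambda>t. sin t / t) has_real_derivative (cos t * t - sin t * 1) / (t * t)) (at t)"
    using t by (auto intro!: derivative_eq_intros)
  moreover have "(cos t * t - sin t * 1) / (t * t) \<le> 0"
    using t x_cos_x_le_sin_x[of t] by (intro divide_nonpos_pos) (auto simp: mult.commute)
  ultimately show "\<exists>z. ((\<lambda>t. sin t / t) has_real_derivative z) (at t) \<and> z \<le> 0" by blast
qed

text \<open>
  With \<open>x = s \<phi> / 2\<close>, the term in \<open>B\<close> increases because the cosine decreases, and for \<open>A \<ge> 0\<close> the term
  in \<open>A\<close> increases with \<open>x / sin x\<close>. For \<open>A < 0\<close>, write \<open>s\<^sup>2 / sin\<^sup>2 x = s\<^sup>2 + (s cot x)\<^sup>2\<close>. Here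
  \<open>s cot x\<close> decreases and has the negative factor \<open>A\<close>, which leaves the quadratic polynomial
  \<open>(1 + c s)\<^sup>2 + A s\<^sup>2 / 4\<close>. Its derivative is linear in \<open>s\<close>, so it suffices that this is positive
  at \<open>0\<close> and at \<open>2\<close>, which is what the two hypotheses on \<open>c\<close> and \<open>A\<close> say.
\<close>

lemma scaled_potential_strict_mono:
  fixes A B c r s \<phi> :: real
  assumes c: "c > 0" and Ac: "2 * c + 4 * c\<^sup>2 + A > 0" and B: "B \<ge> 0"
    and rs: "0 < r" "r < s" "s \<le> 2" and \<phi>: "\<phi> > 0" "s * \<phi> < pi"
  defines "H \<equiv> \<lambda>s. (1 + c * s)\<^sup>2 + s\<^sup>2 * (A / (4 * (sin (s * \<phi> / 2))\<^sup>2) + B / (4 * (cos (s * \<phi> / 2))\<^sup>2))"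
  shows "H r < H s"
proof -
  define x y where "x = r * \<phi> / 2" and "y = s * \<phi> / 2"
  have "r * \<phi> < s * \<phi>" using rs \<phi> by simp
  moreover have "r * \<phi> > 0" using rs \<phi> by simp
  ultimately have xy: "0 < x" "x < y" "y < pi / 2"
    using \<phi> by (auto simp: x_def y_def)
  have sn: "sin x > 0" "sin y > 0" using xy by (auto intro!: sin_gt_zero)
  have cs: "cos y > 0" "cos y < cos x" using xy by (auto intro!: cos_gt_zero cos_monotone_0_pi)
  have s_eq: "r = 2 * x / \<phi>" "s = 2 * y / \<phi>" using \<phi> by (auto simp: x_def y_def)
  have B_part: "r\<^sup>2 * (B / (4 * (cos x)\<^sup>2)) \<le> s\<^sup>2 * (B / (4 * (cos y)\<^sup>2))"
    using rs cs B by (intro mult_mono divide_left_mono power_mono) (auto intro!: power_mono)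
  have A_part: "(1 + c * r)\<^sup>2 + r\<^sup>2 * (A / (4 * (sin x)\<^sup>2)) < (1 + c * s)\<^sup>2 + s\<^sup>2 * (A / (4 * (sin y)\<^sup>2))"
  proof (cases "A \<ge> 0")
    case True
    have "x / sin x \<le> y / sin y"
      using sin_x_over_x_antimono[of x y] xy sn by (simp add: field_simps)
    then have "2 / \<phi> * (x / sin x) \<le> 2 / \<phi> * (y / sin y)"
      using \<phi> by (intro mult_left_mono) auto
    then have "r / sin x \<le> s / sin y" unfolding s_eq by simp
    then have "(r / sin x)\<^sup>2 \<le> (s / sin y)\<^sup>2" using rs sn by (intro power_mono) auto
    then have "A / 4 * (r / sin x)\<^sup>2 \<le> A / 4 * (s / sin y)\<^sup>2" using True by (intro mult_left_mono) auto
    moreover have "(1 + c * r)\<^sup>2 < (1 + c * s)\<^sup>2"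
      using rs c by (intro power_strict_mono) auto
    ultimately show ?thesis by (simp add: power_divide ac_simps)
  next
    case False
    define p q where "p = r * cos x / sin x" and "q = s * cos y / sin y"
    have "q \<le> p"
      using x_cot_x_antimono[of x y] xy \<phi> sn unfolding s_eq p_def q_def by (simp add: field_simps)
    moreover have "q \<ge> 0" using rs cs sn by (simp add: q_def)
    ultimately have "q\<^sup>2 \<le> p\<^sup>2" by (intro power_mono)
    then have "A / 4 * p\<^sup>2 \<le> A / 4 * q\<^sup>2" using False by (intro mult_left_mono_neg) auto
    moreover have "r\<^sup>2 * (A / (4 * (sin x)\<^sup>2)) = A / 4 * r\<^sup>2 + A / 4 * p\<^sup>2"
      using sn by (simp add: p_def power_divide power_mult_distrib cos_squared_eq field_simps)
    moreover have "s\<^sup>2 * (A / (4 * (sin y)\<^sup>2)) = A / 4 * s\<^sup>2 + A / 4 * q\<^sup>2"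
      using sn by (simp add: q_def power_divide power_mult_distrib cos_squared_eq field_simps)
    moreover have "(1 + c * r)\<^sup>2 + A / 4 * r\<^sup>2 < (1 + c * s)\<^sup>2 + A / 4 * s\<^sup>2"
    proof -
      have "2 * c + (c\<^sup>2 + A / 4) * (r + s) > 0"
      proof (cases "c\<^sup>2 + A / 4 \<ge> 0")
        case True
        then show ?thesis using c rs by (intro add_pos_nonneg mult_nonneg_nonneg) auto
      next
        case False
        then have "(c\<^sup>2 + A / 4) * 4 \<le> (c\<^sup>2 + A / 4) * (r + s)"
          using rs by (intro mult_left_mono_neg) auto
        then show ?thesis using Ac by (simp add: algebra_simps)
      qed
      then have "(s - r) * (2 * c + (c\<^sup>2 + A / 4) * (r + s)) > 0" using rs by simp
      then show ?thesis by (simp add: algebra_simps power2_eq_square diff_divide_distrib)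
    qed
    ultimately show ?thesis by linarith
  qed
  show ?thesis
    using A_part B_part unfolding H_def x_def[symmetric] y_def[symmetric]
    by (simp add: distrib_left)
qed

text \<open>
  Since \<open>n + \<rho> = (n - 1/2) + c\<close> with \<open>c = \<rho> + 1/2\<close>, both sides are values of the function of
  \<open>scaled_potential_strict_mono\<close>. Its hypothesis at \<open>s = 2\<close> holds because
  \<open>2 c (2 c + 1) \<ge> (\<alpha> + 3/2) (\<alpha> + 5/2) = \<alpha>\<^sup>2 - 1/4 + 4 (\<alpha> + 1)\<close>; this is where the shift \<open>-1/2\<close> suits
  every \<open>\<alpha> > -1\<close>.
\<close>

lemma scaled_liouville_potential_less:
  fixes \<phi> :: real
  assumes \<alpha>: "\<alpha> > -1" and \<beta>: "\<bar>\<beta>\<bar> \<le> 1/2" and n: "1 \<le> n"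
    and \<phi>: "\<phi> > 0" "1 / (real n - 1/2) * \<phi> < pi"
  shows "(1 / (real n + 1/2))\<^sup>2 * liouville_potential \<alpha> \<beta> (n + 1) (1 / (real n + 1/2) * \<phi>)
       < (1 / (real n - 1/2))\<^sup>2 * liouville_potential \<alpha> \<beta> n (1 / (real n - 1/2) * \<phi>)"
proof -
  \<comment> \<open>Chosen such that \<open>s * (real n + (\<alpha> + \<beta> + 1) / 2) = 1 + c * s\<close> for \<open>s = 1 / (real n - 1/2)\<close>.\<close>
  define c where "c = (\<alpha> + \<beta> + 2) / 2"
  define H where "H s = (1 + c * s)\<^sup>2 + s\<^sup>2 * ((1/4 - \<alpha>\<^sup>2) / (4 * (sin (s * \<phi> / 2))\<^sup>2)
      + (1/4 - \<beta>\<^sup>2) / (4 * (cos (s * \<phi> / 2))\<^sup>2))" for s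
  have H: "(1 / (real m - 1/2))\<^sup>2 * liouville_potential \<alpha> \<beta> m (1 / (real m - 1/2) * \<phi>)
      = H (1 / (real m - 1/2))" if "1 \<le> m" for m
  proof -
    have m: "real m - 1/2 > 0" using that by linarith
    have "real m + (\<alpha> + \<beta> + 1) / 2 = (real m - 1/2) * (1 + c * (1 / (real m - 1/2)))"
      using m by (simp add: c_def field_simps)
    then have "(1 / (real m - 1/2))\<^sup>2 * (real m + (\<alpha> + \<beta> + 1) / 2)\<^sup>2
        = (1 + c * (1 / (real m - 1/2)))\<^sup>2"
      using m by (simp add: power_mult_distrib power_divide)
    then show ?thesis unfolding liouville_potential_def H_def distrib_left[of "(1 / (real m - 1/2))\<^sup>2"]
      by simp
  qed
  have b: "\<beta> \<ge> -1/2" using \<beta> by linarith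
  have "\<bar>\<beta>\<bar>\<^sup>2 \<le> (1/2)\<^sup>2" using \<beta> by (intro power_mono) auto
  then have B: "1/4 - \<beta>\<^sup>2 \<ge> 0" by (simp add: power2_eq_square)
  have c: "2 * c \<ge> \<alpha> + 3/2" using b by (simp add: c_def)
  then have "(\<alpha> + 3/2) * (\<alpha> + 5/2) \<le> 2 * c * (2 * c + 1)"
    using \<alpha> by (intro mult_mono) auto
  then have Ac: "2 * c + 4 * c\<^sup>2 + (1/4 - \<alpha>\<^sup>2) > 0"
    using \<alpha> by (simp add: algebra_simps power2_eq_square)
  have "H (1 / (real (n + 1) - 1/2)) < H (1 / (real n - 1/2))"
    unfolding H_def
  proof (rule scaled_potential_strict_mono[OF _ Ac B _ _ _ \<phi>])
    show "c > 0" using c \<alpha> by linarith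
    show "0 < 1 / (real (n + 1) - 1/2)" by simp
    show "1 / (real (n + 1) - 1/2) < 1 / (real n - 1/2)" using n by (intro divide_strict_left_mono) auto
    show "1 / (real n - 1/2) \<le> 2" using n by (simp add: field_simps)
  qed
  then show ?thesis using H[of n] H[of "n + 1"] n by (simp add: algebra_simps)
qed

lemma DERIV_scaled_jacobi_liouville:
  fixes \<alpha> \<beta> s t :: real and n :: nat
  assumes \<alpha>: "\<alpha> > -1" and \<beta>: "\<beta> > -1" and t: "0 < s * t" "s * t < pi"
  defines "p \<equiv> jacobi_poly \<alpha> \<beta> n"
  shows "((\<lambda>t. liouville \<alpha> \<beta> p (s * t)) has_real_derivative s * liouville_deriv \<alpha> \<beta> p (s * t)) (at t)"
    and "((\<lambda>t. s * liouville_deriv \<alpha> \<beta> p (s * t)) has_real_derivative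
      - (s\<^sup>2 * liouville_potential \<alpha> \<beta> n (s * t)) * liouville \<alpha> \<beta> p (s * t)) (at t)"
proof -
  have st: "((\<lambda>t. s * t) has_real_derivative s) (at t)" by (auto intro!: derivative_eq_intros)
  show "((\<lambda>t. liouville \<alpha> \<beta> p (s * t)) has_real_derivative s * liouville_deriv \<alpha> \<beta> p (s * t)) (at t)"
    using DERIV_chain2[OF DERIV_liouville[OF t] st] by (simp add: mult.commute)
  have "jacobi_op \<alpha> \<beta> p = smult (- jacobi_eigenvalue \<alpha> \<beta> n) p"
    unfolding p_def by (rule jacobi_poly[OF \<alpha> \<beta>])
  from DERIV_cmult[OF DERIV_chain2[OF DERIV_liouville_deriv[OF t this] st], of s]
  show "((\<lambda>t. s * liouville_deriv \<alpha> \<beta> p (s * t)) has_real_derivative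
      - (s\<^sup>2 * liouville_potential \<alpha> \<beta> n (s * t)) * liouville \<alpha> \<beta> p (s * t)) (at t)"
    by (simp add: power2_eq_square mult_ac)
qed

text \<open>
  Here \<open>x\<close> is the left endpoint \<open>0\<close> or a zero of the polynomial of degree \<open>n + 1\<close>, and \<open>y\<close> is the next
  such zero. The last hypothesis keeps the scaled interval inside the shorter domain \<open>(0, (n - 1/2) \<pi>)\<close> of
  the equation for degree \<open>n\<close>.
\<close>

lemma jacobi_scaled_interlacing:
  assumes \<alpha>: "\<alpha> > -1" and \<beta>: "\<bar>\<beta>\<bar> \<le> 1/2" and n: "1 \<le> n"
    and x: "x = 0 \<or> x \<in> jacobi_angles \<alpha> \<beta> (n + 1)" and y: "y \<in> jacobi_angles \<alpha> \<beta> (n + 1)"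
    and xy: "x < y" and gap: "\<And>t. x < t \<Longrightarrow> t < y \<Longrightarrow> t \<notin> jacobi_angles \<alpha> \<beta> (n + 1)"
    and y_less: "(real n + 1/2) * y < (real n - 1/2) * pi"
  shows "\<exists>\<theta>\<in>jacobi_angles \<alpha> \<beta> n. (real n + 1/2) * x < (real n - 1/2) * \<theta>
           \<and> (real n - 1/2) * \<theta> < (real n + 1/2) * y"
proof -
  have \<beta>': "\<beta> > -1" using \<beta> by linarith
  define r s where "r = 1 / (real n + 1/2)" and "s = 1 / (real n - 1/2)"
  have rs: "r > 0" "s > 0" "r < s"
    using n by (auto simp: r_def s_def intro!: divide_strict_left_mono)
  define a b where "a = (real n + 1/2) * x" and "b = (real n + 1/2) * y"
  have x0: "0 \<le> x" and y\<pi>: "y < pi" using x y by (auto simp: jacobi_angles_def)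
  have ab: "a < b" "0 \<le> a" using xy x0 by (auto simp: a_def b_def)
  have ra: "r * a = x" and rb: "r * b = y" by (auto simp: r_def a_def b_def)
  have sb: "s * b < pi" using y_less n unfolding s_def b_def by (simp add: field_simps)
  have r_mono: "r * t < y" "x < r * t" if "a < t" "t < b" for t
    using that rs(1) by (simp_all flip: ra rb)
  have r_in: "0 < r * t" "r * t < pi" if "t \<in> {a<..b}" for t
  proof -
    show "0 < r * t" using that ab rs by auto
    have "r * t \<le> r * b" using that rs by simp
    then show "r * t < pi" using rb y\<pi> by linarith
  qed
  have s_in: "0 < s * t" "s * t < pi" if "t \<in> {a<..b}" for t
  proof -
    show "0 < s * t" using that ab rs by auto
    have "s * t \<le> s * b" using that rs by simp
    then show "s * t < pi" using sb by linarith
  qed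
  let ?p = "jacobi_poly \<alpha> \<beta> n" and ?q = "jacobi_poly \<alpha> \<beta> (n + 1)"
  note dp = DERIV_scaled_jacobi_liouville[OF \<alpha> \<beta>', where n = n and s = s]
    and dq = DERIV_scaled_jacobi_liouville[OF \<alpha> \<beta>', where n = "n + 1" and s = r]
  have left: "((\<lambda>t. liouville \<alpha> \<beta> ?p (s * t) * (r * liouville_deriv \<alpha> \<beta> ?q (r * t))
        - s * liouville_deriv \<alpha> \<beta> ?p (s * t) * liouville \<alpha> \<beta> ?q (r * t)) \<longlongrightarrow> 0) (at_right a)
      \<or> liouville \<alpha> \<beta> ?q (r * a) = 0 \<and> isCont (\<lambda>t. liouville \<alpha> \<beta> ?p (s * t)) a
        \<and> isCont (\<lambda>t. s * liouville_deriv \<alpha> \<beta> ?p (s * t)) a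
        \<and> ((\<lambda>t. liouville \<alpha> \<beta> ?q (r * t)) has_real_derivative r * liouville_deriv \<alpha> \<beta> ?q (r * a)) (at a)
        \<and> isCont (\<lambda>t. r * liouville_deriv \<alpha> \<beta> ?q (r * t)) a"
  proof (cases "x = 0")
    case True
    then have "a = 0" by (simp add: a_def)
    then show ?thesis using liouville_wronskian_limit[OF \<alpha> rs(2) rs(1), of \<beta> ?p ?q] by simp
  next
    case False
    with x have xz: "0 < x" "x < pi" "poly ?q (cos x) = 0" by (auto simp: jacobi_angles_def)
    have "0 < a" using xz by (simp add: a_def)
    have "s * a < s * b" using ab rs by simp
    then have "s * a < pi" using sb by linarith
    then have "0 < s * a" "s * a < pi" "0 < r * a" "r * a < pi"
      using xz rs \<open>0 < a\<close> ra by auto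
    note d = dp[OF this(1,2)] dq[OF this(3,4)]
    show ?thesis
      using d DERIV_isCont[OF d(1)] DERIV_isCont[OF d(2)] DERIV_isCont[OF d(4)] xz
      by (simp add: ra liouville_eq_0_iff)
  qed
  have "\<exists>t\<in>{a<..<b}. liouville \<alpha> \<beta> ?p (s * t) = 0"
  proof (rule sturm_comparison[OF ab(1) dp(1) dp(2) dq(1) dq(2) _ _ _ left])
    fix t assume "t \<in> {a<..<b}"
    then have t: "a < t" "t < b" "t \<in> {a<..b}" by auto
    show "r\<^sup>2 * liouville_potential \<alpha> \<beta> (n + 1) (r * t) < s\<^sup>2 * liouville_potential \<alpha> \<beta> n (s * t)"
      using scaled_liouville_potential_less[OF \<alpha> \<beta> n, of t] s_in[OF t(3)] t ab
      by (simp add: r_def s_def)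
    show "liouville \<alpha> \<beta> ?q (r * t) \<noteq> 0"
      using gap[of "r * t"] r_mono[OF t(1,2)] r_in[OF t(3)]
      by (auto simp: liouville_eq_0_iff jacobi_angles_def)
  next
    show "liouville \<alpha> \<beta> ?q (r * b) = 0"
      using y by (simp add: rb liouville_eq_0_iff jacobi_angles_def)
  qed (use s_in r_in in auto)
  then obtain t where t: "a < t" "t < b" "liouville \<alpha> \<beta> ?p (s * t) = 0" by auto
  then have "s * t \<in> jacobi_angles \<alpha> \<beta> n"
    using s_in[of t] by (simp add: jacobi_angles_def liouville_eq_0_iff)
  moreover have e: "(real n - 1/2) * (s * t) = t" using n by (simp add: s_def)
  have "(real n + 1/2) * x < (real n - 1/2) * (s * t)" "(real n - 1/2) * (s * t) < (real n + 1/2) * y"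
    unfolding e using t(1,2) by (simp_all add: a_def b_def)
  ultimately show ?thesis by blast
qed

text \<open>
  Each interval between consecutive scaled zeros of degree \<open>n + 1\<close> below \<open>(n - 1/2) \<pi>\<close>, including
  the one that starts at \<open>0\<close>, holds a scaled zero of degree \<open>n\<close>. So the \<open>k\<close>-th zero of the latter kind comes before the
  \<open>k\<close>-th one of the former kind.
\<close>

lemma jacobi_theta_scaled_mono:
  assumes \<alpha>: "\<alpha> > -1" and \<beta>: "\<bar>\<beta>\<bar> \<le> 1/2" and n: "1 \<le> n" and k: "1 \<le> k" "k \<le> n"
  shows "(real n - 1/2) * jacobi_theta \<alpha> \<beta> n k \<le> (real n + 1/2) * jacobi_theta \<alpha> \<beta> (n + 1) k"
  using k
proof (induction k rule: nat_induct)
  case (Suc k)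
  have \<beta>': "\<beta> > -1" using \<beta> by linarith
  note in_angles = jacobi_theta_in_angles[OF \<alpha> \<beta>'] and less_iff = jacobi_theta_less_iff[OF \<alpha> \<beta>']
  define x where "x = (if k = 0 then 0 else jacobi_theta \<alpha> \<beta> (n + 1) k)"
  define y where "y = jacobi_theta \<alpha> \<beta> (n + 1) (Suc k)"
  have y: "y \<in> jacobi_angles \<alpha> \<beta> (n + 1)" unfolding y_def using Suc.prems by (intro in_angles) auto
  show ?case
  proof (cases "(real n + 1/2) * y < (real n - 1/2) * pi")
    case False
    \<comment> \<open>The scaled zero of degree \<open>n + 1\<close> is beyond all possible scaled zeros of degree \<open>n\<close>.\<close>
    have "jacobi_theta \<alpha> \<beta> n (Suc k) < pi"
      using in_angles[of "Suc k" n] Suc.prems by (simp add: jacobi_angles_def)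
    then have "(real n - 1/2) * jacobi_theta \<alpha> \<beta> n (Suc k) \<le> (real n - 1/2) * pi"
      using n by (intro mult_left_mono) auto
    then show ?thesis using False by (simp add: y_def)
  next
    case True
    have "\<exists>\<theta>\<in>jacobi_angles \<alpha> \<beta> n. (real n + 1/2) * x < (real n - 1/2) * \<theta>
           \<and> (real n - 1/2) * \<theta> < (real n + 1/2) * y"
    proof (rule jacobi_scaled_interlacing[OF \<alpha> \<beta> n _ y _ _ True])
      show "x = 0 \<or> x \<in> jacobi_angles \<alpha> \<beta> (n + 1)"
        using in_angles[of k "n + 1"] Suc.prems by (auto simp: x_def)
      show "x < y"
        using y Suc.prems less_iff[of k "n + 1" "Suc k"]
        by (auto simp: x_def y_def jacobi_angles_def)
      show "t \<notin> jacobi_angles \<alpha> \<beta> (n + 1)" if "x < t" "t < y" for t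
      proof (cases "k = 0")
        case True
        show ?thesis
        proof
          assume "t \<in> jacobi_angles \<alpha> \<beta> (n + 1)"
          then obtain j where "1 \<le> j" "j \<le> n + 1" "t = jacobi_theta \<alpha> \<beta> (n + 1) j"
            by (rule jacobi_angles_obtain_index[OF \<alpha> \<beta>'])
          then show False using that True less_iff[of j "n + 1" 1] by (auto simp: y_def)
        qed
      next
        case False
        then show ?thesis
          using jacobi_theta_gap[OF \<alpha> \<beta>', of k "n + 1" t] that Suc.prems by (simp add: x_def y_def)
      qed
    qed
    then obtain j where j: "1 \<le> j" "j \<le> n"
      "(real n + 1/2) * x < (real n - 1/2) * jacobi_theta \<alpha> \<beta> n j"
      "(real n - 1/2) * jacobi_theta \<alpha> \<beta> n j < (real n + 1/2) * y"
      by (metis jacobi_angles_obtain_index[OF \<alpha> \<beta>'])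
    have "k < j"
    proof (cases "k = 0")
      case False
      then have "(real n - 1/2) * jacobi_theta \<alpha> \<beta> n k \<le> (real n + 1/2) * x"
        using Suc by (simp add: x_def)
      then have "(real n - 1/2) * jacobi_theta \<alpha> \<beta> n k < (real n - 1/2) * jacobi_theta \<alpha> \<beta> n j"
        using j(3) by linarith
      then have "jacobi_theta \<alpha> \<beta> n k < jacobi_theta \<alpha> \<beta> n j"
        using n by (simp add: mult_less_cancel_left)
      then show ?thesis using less_iff[of k n j] False j Suc.prems by simp
    qed (use j in simp)
    then have "jacobi_theta \<alpha> \<beta> n (Suc k) \<le> jacobi_theta \<alpha> \<beta> n j"
      using less_iff[of j n "Suc k"] j Suc.prems by (simp add: not_less[symmetric])
    then have "(real n - 1/2) * jacobi_theta \<alpha> \<beta> n (Suc k) \<le> (real n - 1/2) * jacobi_theta \<alpha> \<beta> n j"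
      using n by (intro mult_left_mono) auto
    then show ?thesis using j(4) by (simp add: y_def)
  qed
qed simp

section \<open>Failure of monotonicity for a large second exponent\<close>

lemma half_sine_bounds:
  fixes x :: real
  assumes "0 < x" "x \<le> pi / 2"
  shows "x / pi \<le> sin (x / 2)" "sin (x / 2) \<le> x / 2" "1 / 2 \<le> (cos (x / 2))\<^sup>2"
proof -
  have "sin (pi / 2) / (pi / 2) \<le> sin (x / 2) / (x / 2)"
    using assms by (intro sin_x_over_x_antimono) auto
  then show "x / pi \<le> sin (x / 2)" using assms by (simp add: field_simps)
  show "sin (x / 2) \<le> x / 2" using assms by (intro sin_x_le_x) auto
  have "cos x \<ge> 0" using assms by (intro cos_ge_zero) auto
  then show "1 / 2 \<le> (cos (x / 2))\<^sup>2" using cos_double_cos[of "x / 2"] by simp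
qed

text \<open>
  The two singular terms at distance \<open>x\<close> from \<open>\<pi>\<close>: the one in \<open>\<alpha>\<close> is bounded there, while the one in
  \<open>\<beta>\<close> is negative and comparable to \<open>- 1 / x\<^sup>2\<close>.
\<close>

lemma liouville_potential_near_pi:
  fixes x :: real
  assumes \<beta>: "\<bar>\<beta>\<bar> > 1/2" and x: "0 < x" "x \<le> pi / 2"
  shows "(real n + (\<alpha> + \<beta> + 1) / 2)\<^sup>2 - \<bar>1/4 - \<alpha>\<^sup>2\<bar> / 2 - (\<beta>\<^sup>2 - 1/4) * pi\<^sup>2 / (4 * x\<^sup>2)
           \<le> liouville_potential \<alpha> \<beta> n (pi - x)"
    and "liouville_potential \<alpha> \<beta> n (pi - x)
           \<le> (real n + (\<alpha> + \<beta> + 1) / 2)\<^sup>2 + \<bar>1/4 - \<alpha>\<^sup>2\<bar> / 2 - (\<beta>\<^sup>2 - 1/4) / x\<^sup>2"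
proof -
  note h = half_sine_bounds[OF x]
  have "(1/2)\<^sup>2 < \<bar>\<beta>\<bar>\<^sup>2" using \<beta> by (intro power_strict_mono) auto
  then have B: "\<beta>\<^sup>2 - 1/4 > 0" by (simp add: power2_eq_square)
  have sn: "sin ((pi - x) / 2) = cos (x / 2)" "cos ((pi - x) / 2) = sin (x / 2)"
    by (simp_all add: diff_divide_distrib sin_diff cos_diff)
  have spos: "sin (x / 2) > 0" using x by (intro sin_gt_zero) auto
  have "\<bar>(1/4 - \<alpha>\<^sup>2) / (4 * (cos (x / 2))\<^sup>2)\<bar> = \<bar>1/4 - \<alpha>\<^sup>2\<bar> / (4 * (cos (x / 2))\<^sup>2)"
    by (simp add: abs_divide)
  also have "\<dots> \<le> \<bar>1/4 - \<alpha>\<^sup>2\<bar> / 2" using h(3) by (intro divide_left_mono) auto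
  finally have A: "\<bar>(1/4 - \<alpha>\<^sup>2) / (4 * (cos (x / 2))\<^sup>2)\<bar> \<le> \<bar>1/4 - \<alpha>\<^sup>2\<bar> / 2" .
  have "(x / pi)\<^sup>2 \<le> (sin (x / 2))\<^sup>2" using h(1) x by (intro power_mono) auto
  then have "(\<beta>\<^sup>2 - 1/4) / (4 * (sin (x / 2))\<^sup>2) \<le> (\<beta>\<^sup>2 - 1/4) / (4 * (x / pi)\<^sup>2)"
    using B x spos by (intro divide_left_mono) auto
  also have "\<dots> = (\<beta>\<^sup>2 - 1/4) * pi\<^sup>2 / (4 * x\<^sup>2)" by (simp add: power_divide)
  finally have 1: "(\<beta>\<^sup>2 - 1/4) / (4 * (sin (x / 2))\<^sup>2) \<le> (\<beta>\<^sup>2 - 1/4) * pi\<^sup>2 / (4 * x\<^sup>2)" .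
  have "(sin (x / 2))\<^sup>2 \<le> (x / 2)\<^sup>2" using h(2) spos by (intro power_mono) auto
  then have "4 * (sin (x / 2))\<^sup>2 \<le> x\<^sup>2" by (simp add: power_divide)
  then have 2: "(\<beta>\<^sup>2 - 1/4) / x\<^sup>2 \<le> (\<beta>\<^sup>2 - 1/4) / (4 * (sin (x / 2))\<^sup>2)"
    using B x spos by (intro divide_left_mono) auto
  have bounds: "\<bar>u\<bar> \<le> a \<Longrightarrow> v \<le> w \<Longrightarrow> R - a - w \<le> R + u - v"
    "\<bar>u\<bar> \<le> a \<Longrightarrow> w \<le> v \<Longrightarrow> R + u - v \<le> R + a - w" for u v w a R :: real
    by linarith+
  have Q: "liouville_potential \<alpha> \<beta> n (pi - x) = (real n + (\<alpha> + \<beta> + 1) / 2)\<^sup>2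
      + (1/4 - \<alpha>\<^sup>2) / (4 * (cos (x / 2))\<^sup>2) - (\<beta>\<^sup>2 - 1/4) / (4 * (sin (x / 2))\<^sup>2)"
    unfolding liouville_potential_def sn by (simp add: diff_divide_distrib)
  show "(real n + (\<alpha> + \<beta> + 1) / 2)\<^sup>2 - \<bar>1/4 - \<alpha>\<^sup>2\<bar> / 2 - (\<beta>\<^sup>2 - 1/4) * pi\<^sup>2 / (4 * x\<^sup>2)
           \<le> liouville_potential \<alpha> \<beta> n (pi - x)"
    unfolding Q using A 1 by (rule bounds)
  show "liouville_potential \<alpha> \<beta> n (pi - x)
           \<le> (real n + (\<alpha> + \<beta> + 1) / 2)\<^sup>2 + \<bar>1/4 - \<alpha>\<^sup>2\<bar> / 2 - (\<beta>\<^sup>2 - 1/4) / x\<^sup>2"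
    unfolding Q using A 2 by (rule bounds)
qed

lemma DERIV_sine_wave:
  fixes \<omega> a t :: real
  shows "((\<lambda>t. sin (\<omega> * (t - a))) has_real_derivative \<omega> * cos (\<omega> * (t - a))) (at t)"
    and "((\<lambda>t. \<omega> * cos (\<omega> * (t - a))) has_real_derivative - \<omega>\<^sup>2 * sin (\<omega> * (t - a))) (at t)"
  by (auto intro!: derivative_eq_intros simp: power2_eq_square)

text \<open>
  Comparison with a sine wave of frequency \<open>\<omega>\<close> over half a period.
\<close>

lemma jacobi_angle_in_interval:
  fixes \<omega> a :: real
  assumes \<alpha>: "\<alpha> > -1" and \<beta>: "\<beta> > -1" and \<omega>: "\<omega> > 0" and a: "0 < a" "a + pi / \<omega> < pi"
    and Q: "\<And>t. a < t \<Longrightarrow> t < a + pi / \<omega> \<Longrightarrow> \<omega>\<^sup>2 < liouville_potential \<alpha> \<beta> n t"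
  shows "\<exists>t\<in>jacobi_angles \<alpha> \<beta> n. a < t \<and> t < a + pi / \<omega>"
proof -
  let ?p = "jacobi_poly \<alpha> \<beta> n" and ?b = "a + pi / \<omega>"
  note ode = DERIV_liouville DERIV_liouville_deriv[OF _ _ jacobi_poly(2)[OF \<alpha> \<beta>]]
  have "a < ?b" using \<omega> by simp
  then have "a < pi" using a by linarith
  have "\<exists>t\<in>{a<..<?b}. liouville \<alpha> \<beta> ?p t = 0"
  proof (rule sturm_comparison[OF \<open>a < ?b\<close> ode DERIV_sine_wave])
    show "sin (\<omega> * (t - a)) \<noteq> 0" if "t \<in> {a<..<?b}" for t
    proof -
      have "0 < \<omega> * (t - a)" "\<omega> * (t - a) < pi" using that \<omega> by (auto simp: field_simps)
      then show ?thesis using sin_gt_zero by force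
    qed
    have c: "isCont (liouville \<alpha> \<beta> ?p) a" "isCont (liouville_deriv \<alpha> \<beta> ?p) a"
      using ode(1)[OF a(1) \<open>a < pi\<close>] ode(2)[OF a(1) \<open>a < pi\<close>] DERIV_isCont by blast+
    show "((\<lambda>t. liouville \<alpha> \<beta> ?p t * (\<omega> * cos (\<omega> * (t - a)))
          - liouville_deriv \<alpha> \<beta> ?p t * sin (\<omega> * (t - a))) \<longlongrightarrow> 0) (at_right a)
        \<or> sin (\<omega> * (a - a)) = 0 \<and> isCont (liouville \<alpha> \<beta> ?p) a \<and> isCont (liouville_deriv \<alpha> \<beta> ?p) a
          \<and> ((\<lambda>t. sin (\<omega> * (t - a))) has_real_derivative \<omega> * cos (\<omega> * (a - a))) (at a)
          \<and> isCont (\<lambda>t. \<omega> * cos (\<omega> * (t - a))) a"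
      using c DERIV_sine_wave(1)[of \<omega> a a] by (intro disjI2 conjI) (auto intro!: continuous_intros)
  qed (use a \<omega> Q in auto)
  then obtain t where t: "a < t" "t < ?b" "liouville \<alpha> \<beta> ?p t = 0" by auto
  then have "0 < t" "t < pi" using a by linarith+
  then have "t \<in> jacobi_angles \<alpha> \<beta> n" using t(3) by (simp add: jacobi_angles_def liouville_eq_0_iff)
  then show ?thesis using t by blast
qed

text \<open>
  The reverse comparison: the sine wave that starts at \<open>a\<close> must vanish again before \<open>b\<close>.
\<close>

lemma jacobi_angles_gap_lower_bound:
  fixes \<omega> a b :: real
  assumes \<alpha>: "\<alpha> > -1" and \<beta>: "\<beta> > -1" and \<omega>: "\<omega> > 0"
    and a: "a \<in> jacobi_angles \<alpha> \<beta> n" and b: "b \<in> jacobi_angles \<alpha> \<beta> n" and ab: "a < b"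
    and gap: "\<And>t. a < t \<Longrightarrow> t < b \<Longrightarrow> t \<notin> jacobi_angles \<alpha> \<beta> n"
    and Q: "\<And>t. a < t \<Longrightarrow> t < b \<Longrightarrow> liouville_potential \<alpha> \<beta> n t < \<omega>\<^sup>2"
  shows "pi / \<omega> < b - a"
proof (rule ccontr)
  assume short: "\<not> ?thesis"
  let ?p = "jacobi_poly \<alpha> \<beta> n"
  note ode = DERIV_liouville DERIV_liouville_deriv[OF _ _ jacobi_poly(2)[OF \<alpha> \<beta>]]
  have a': "0 < a" "a < pi" "poly ?p (cos a) = 0" and b': "0 < b" "b < pi" "poly ?p (cos b) = 0"
    using a b by (auto simp: jacobi_angles_def)
  have "\<exists>t\<in>{a<..<b}. sin (\<omega> * (t - a)) = 0"
  proof (rule sturm_comparison[OF ab DERIV_sine_wave ode])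
    show "liouville \<alpha> \<beta> ?p t \<noteq> 0" if "t \<in> {a<..<b}" for t
      using gap[of t] that a' b' by (auto simp: jacobi_angles_def liouville_eq_0_iff)
    have "isCont (liouville_deriv \<alpha> \<beta> ?p) a"
      using ode(2)[OF a'(1,2)] DERIV_isCont by blast
    then show "((\<lambda>t. sin (\<omega> * (t - a)) * liouville_deriv \<alpha> \<beta> ?p t
          - \<omega> * cos (\<omega> * (t - a)) * liouville \<alpha> \<beta> ?p t) \<longlongrightarrow> 0) (at_right a)
        \<or> liouville \<alpha> \<beta> ?p a = 0 \<and> isCont (\<lambda>t. sin (\<omega> * (t - a))) a
          \<and> isCont (\<lambda>t. \<omega> * cos (\<omega> * (t - a))) a
          \<and> (liouville \<alpha> \<beta> ?p has_real_derivative liouville_deriv \<alpha> \<beta> ?p a) (at a)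
          \<and> isCont (liouville_deriv \<alpha> \<beta> ?p) a"
      using a' ode(1)[OF a'(1,2)] by (intro disjI2 conjI) (auto simp: liouville_eq_0_iff)
  qed (use a' b' Q in \<open>auto simp: liouville_eq_0_iff\<close>)
  then obtain t where t: "a < t" "t < b" "sin (\<omega> * (t - a)) = 0" by auto
  have "t - a < pi / \<omega>" using short t by linarith
  then have "0 < \<omega> * (t - a)" "\<omega> * (t - a) < pi" using t \<omega> by (auto simp: field_simps)
  then show False using sin_gt_zero t(3) by force
qed

text \<open>
  At distance at least \<open>pi * sqrt (\<beta>\<^sup>2 - 1/4) / n\<close> and at most \<open>\<pi> / 2\<close> from \<open>\<pi>\<close>, the singular term
  takes at most \<open>n\<^sup>2 / 4\<close> away from the potential, which therefore exceeds \<open>(n / 2)\<^sup>2\<close> for large \<open>n\<close>. Adding \<open>4 * pi / n\<close>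
  makes room for two half-waves of frequency \<open>n / 2\<close>, and hence for two zeros.
\<close>

lemma penultimate_jacobi_angle_near_pi:
  assumes \<alpha>: "\<alpha> > -1" and \<beta>: "\<beta> > -1" and \<beta>2: "\<bar>\<beta>\<bar> > 1/2"
  defines "C \<equiv> pi * sqrt (\<beta>\<^sup>2 - 1/4) + 4 * pi"
  shows "\<forall>\<^sub>F n in sequentially. pi - C / real n < jacobi_theta \<alpha> \<beta> n (n - 1)"
proof -
  define c where "c = pi * sqrt (\<beta>\<^sup>2 - 1/4)"
  have "(1/2)\<^sup>2 < \<bar>\<beta>\<bar>\<^sup>2" using \<beta>2 by (intro power_strict_mono) auto
  then have B: "\<beta>\<^sup>2 - 1/4 > 0" by (simp add: power2_eq_square)
  then have c: "c > 0" "c\<^sup>2 = pi\<^sup>2 * (\<beta>\<^sup>2 - 1/4)"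
    by (auto simp: c_def power_mult_distrib)
  have C: "C = c + 4 * pi" by (simp add: C_def c_def)
  have ev1: "\<forall>\<^sub>F n in sequentially. real n * (pi / 2) > C" by real_asymp
  have ev2: "\<forall>\<^sub>F n in sequentially. (real n + (\<alpha> + \<beta> + 1) / 2)\<^sup>2 - \<bar>1/4 - \<alpha>\<^sup>2\<bar> / 2 > (real n)\<^sup>2 / 2"
    by real_asymp
  show ?thesis using ev1 ev2 eventually_ge_at_top[of 2]
  proof eventually_elim
    case (elim n)
    then have n: "real n > 0" by simp
    have Cn: "C / real n < pi / 2" using elim(1) n by (simp add: field_simps)
    have Q: "(real n / 2)\<^sup>2 < liouville_potential \<alpha> \<beta> n t"
      if t: "pi - C / real n < t" "t < pi - c / real n" for t
    proof -
      define x where "x = pi - t"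
      have x: "c / real n < x" "x \<le> pi / 2" using t Cn by (auto simp: x_def)
      have "c / real n > 0" using c n by simp
      then have "0 < x" using x by linarith
      have "(c / real n)\<^sup>2 < x\<^sup>2"
        using x \<open>c / real n > 0\<close> by (intro power_strict_mono) auto
      then have "(\<beta>\<^sup>2 - 1/4) * pi\<^sup>2 / (4 * x\<^sup>2) \<le> (\<beta>\<^sup>2 - 1/4) * pi\<^sup>2 / (4 * (c / real n)\<^sup>2)"
        using B c(1) n x(1) \<open>0 < x\<close> by (intro divide_left_mono) auto
      also have "\<dots> = (real n)\<^sup>2 / 4"
        using B n by (simp add: power_divide c(2))
      finally have "(\<beta>\<^sup>2 - 1/4) * pi\<^sup>2 / (4 * x\<^sup>2) \<le> (real n)\<^sup>2 / 4" .
      moreover note liouville_potential_near_pi(1)[OF \<beta>2 \<open>0 < x\<close> x(2), of n \<alpha>]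
      ultimately have "(real n)\<^sup>2 / 4 < liouville_potential \<alpha> \<beta> n (pi - x)"
        using elim(2) by linarith
      then show ?thesis by (simp add: x_def power_divide)
    qed
    have w: "real n / 2 > 0" using n by simp
    have e1: "pi - C / real n + pi / (real n / 2) = pi - (c + 2 * pi) / real n"
      and e2: "pi - (c + 2 * pi) / real n + pi / (real n / 2) = pi - c / real n"
      using n by (simp_all add: C field_simps)
    have pos: "pi / (real n / 2) > 0" "c / real n > 0" using n c by auto
    have "\<exists>t\<in>jacobi_angles \<alpha> \<beta> n. pi - C / real n < t \<and> t < pi - C / real n + pi / (real n / 2)"
      by (rule jacobi_angle_in_interval[OF \<alpha> \<beta> w]) (use Cn Q e1 e2 pos in auto)
    then obtain t where t: "t \<in> jacobi_angles \<alpha> \<beta> n" "pi - C / real n < t" "t < pi - (c + 2 * pi) / real n"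
      unfolding e1 by blast
    have "\<exists>t\<in>jacobi_angles \<alpha> \<beta> n. pi - (c + 2 * pi) / real n < t
        \<and> t < pi - (c + 2 * pi) / real n + pi / (real n / 2)"
      by (rule jacobi_angle_in_interval[OF \<alpha> \<beta> w]) (use Cn Q e1 e2 pos in auto)
    then obtain t' where t': "t' \<in> jacobi_angles \<alpha> \<beta> n" "pi - (c + 2 * pi) / real n < t'"
      by blast
    obtain j where j: "1 \<le> j" "j \<le> n" "t = jacobi_theta \<alpha> \<beta> n j"
      by (rule jacobi_angles_obtain_index[OF \<alpha> \<beta> t(1)])
    obtain k where k: "1 \<le> k" "k \<le> n" "t' = jacobi_theta \<alpha> \<beta> n k"
      by (rule jacobi_angles_obtain_index[OF \<alpha> \<beta> t'(1)])
    note less_iff = jacobi_theta_less_iff[OF \<alpha> \<beta>]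
    have "j < k" using less_iff[of j n k] j k t t' by linarith
    then have "\<not> jacobi_theta \<alpha> \<beta> n (n - 1) < jacobi_theta \<alpha> \<beta> n j"
      using less_iff[of "n - 1" n j] j k elim(3) by auto
    then show ?case using t j by linarith
  qed
qed

text \<open>
  Within distance \<open>C / n\<close> of \<open>\<pi>\<close> the singular term takes at least \<open>2 * d * n\<^sup>2\<close> away from the potential,
  where \<open>2 * d = (\<beta>\<^sup>2 - 1/4) / C\<^sup>2\<close>. Half of this absorbs the terms of lower order, and
  \<open>(1 - d) * n\<^sup>2\<close> remains as an upper bound.
\<close>

lemma last_jacobi_gap_large:
  assumes \<alpha>: "\<alpha> > -1" and \<beta>: "\<beta> > -1" and \<beta>2: "\<bar>\<beta>\<bar> > 1/2"
  shows "\<exists>\<kappa>. 0 < \<kappa> \<and> \<kappa> < 1 \<and> (\<forall>\<^sub>F n in sequentially.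
    pi / (\<kappa> * real n) < jacobi_theta \<alpha> \<beta> n n - jacobi_theta \<alpha> \<beta> n (n - 1))"
proof -
  define C where "C = pi * sqrt (\<beta>\<^sup>2 - 1/4) + 4 * pi"
  have "(1/2)\<^sup>2 < \<bar>\<beta>\<bar>\<^sup>2" using \<beta>2 by (intro power_strict_mono) auto
  then have B: "\<beta>\<^sup>2 - 1/4 > 0" by (simp add: power2_eq_square)
  define d where "d = (\<beta>\<^sup>2 - 1/4) / (2 * C\<^sup>2)"
  have C: "C > sqrt (\<beta>\<^sup>2 - 1/4)" "C > 0"
  proof -
    have "1 * sqrt (\<beta>\<^sup>2 - 1/4) \<le> pi * sqrt (\<beta>\<^sup>2 - 1/4)"
      using pi_gt3 B by (intro mult_right_mono) auto
    then show "C > sqrt (\<beta>\<^sup>2 - 1/4)" using pi_gt_zero unfolding C_def by linarith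
    then show "C > 0" using B by (smt (verit) real_sqrt_gt_zero)
  qed
  have "(sqrt (\<beta>\<^sup>2 - 1/4))\<^sup>2 < C\<^sup>2" using C B by (intro power_strict_mono) auto
  then have d: "0 < d" "d < 1" using B C by (auto simp: d_def field_simps)
  define \<kappa> where "\<kappa> = sqrt (1 - d)"
  have \<kappa>: "0 < \<kappa>" "\<kappa> < 1" "\<kappa>\<^sup>2 = 1 - d" using d by (auto simp: \<kappa>_def)
  have ev1: "\<forall>\<^sub>F n in sequentially. real n * (pi / 2) > C" by real_asymp
  have ev2: "\<forall>\<^sub>F n in sequentially.
      (real n + (\<alpha> + \<beta> + 1) / 2)\<^sup>2 + \<bar>1/4 - \<alpha>\<^sup>2\<bar> / 2 < (1 + d) * (real n)\<^sup>2"
    using d by real_asymp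
  have "\<forall>\<^sub>F n in sequentially.
    pi / (\<kappa> * real n) < jacobi_theta \<alpha> \<beta> n n - jacobi_theta \<alpha> \<beta> n (n - 1)"
    using penultimate_jacobi_angle_near_pi[OF \<alpha> \<beta> \<beta>2, folded C_def] ev1 ev2
      eventually_ge_at_top[of 2]
  proof eventually_elim
    case (elim n)
    then have n: "real n > 0" by simp
    have Cn: "C / real n < pi / 2" using elim(2) n by (simp add: field_simps)
    let ?a = "jacobi_theta \<alpha> \<beta> n (n - 1)" and ?b = "jacobi_theta \<alpha> \<beta> n n"
    have b\<pi>: "?b < pi" using jacobi_theta_in_angles[OF \<alpha> \<beta>, of n n] elim(4)
      by (simp add: jacobi_angles_def)
    show ?case
    proof (rule jacobi_angles_gap_lower_bound[OF \<alpha> \<beta>])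
      show "\<kappa> * real n > 0" using \<kappa> n by simp
      show "?a \<in> jacobi_angles \<alpha> \<beta> n" "?b \<in> jacobi_angles \<alpha> \<beta> n"
        using elim(4) by (auto intro!: jacobi_theta_in_angles[OF \<alpha> \<beta>])
      show "?a < ?b" using elim(4) by (intro jacobi_theta_strict_mono[OF \<alpha> \<beta>]) auto
      show "t \<notin> jacobi_angles \<alpha> \<beta> n" if "?a < t" "t < ?b" for t
        using jacobi_theta_gap[OF \<alpha> \<beta>, of "n - 1" n t] that elim(4) by simp
      show "liouville_potential \<alpha> \<beta> n t < (\<kappa> * real n)\<^sup>2" if "?a < t" "t < ?b" for t
      proof -
        define x where "x = pi - t"
        have x: "0 < x" "x < C / real n" using that b\<pi> elim(1) by (auto simp: x_def)
        then have "x\<^sup>2 < (C / real n)\<^sup>2" by (intro power_strict_mono) auto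
        then have "(\<beta>\<^sup>2 - 1/4) / (C / real n)\<^sup>2 \<le> (\<beta>\<^sup>2 - 1/4) / x\<^sup>2"
          using B x C(2) n by (intro divide_left_mono) auto
        moreover have "(\<beta>\<^sup>2 - 1/4) / (C / real n)\<^sup>2 = 2 * d * (real n)\<^sup>2"
          using C by (simp add: d_def power_divide field_simps)
        moreover have "x \<le> pi / 2" using x Cn by linarith
        note liouville_potential_near_pi(2)[OF \<beta>2 x(1) this, of \<alpha> n]
        ultimately have "liouville_potential \<alpha> \<beta> n t < (1 - d) * (real n)\<^sup>2"
          using elim(3) by (simp add: x_def algebra_simps)
        then show ?thesis by (simp add: power_mult_distrib \<kappa>(3))
      qed
    qed
  qed
  with \<kappa> show ?thesis by blast
qed

lemma no_eventual_steady_decrease: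
  fixes d :: "nat \<Rightarrow> real"
  assumes "\<delta> > 0" and dec: "\<forall>\<^sub>F n in sequentially. d (Suc n) \<le> d n - \<delta>"
    and nonneg: "\<And>n. n \<ge> 1 \<Longrightarrow> d n \<ge> 0"
  shows False
proof -
  obtain N where N: "\<And>n. n \<ge> N \<Longrightarrow> d (Suc n) \<le> d n - \<delta>"
    using dec by (auto simp: eventually_sequentially)
  have le: "d (N + m) \<le> d N - real m * \<delta>" for m
  proof (induction m)
    case (Suc m)
    then show ?case using N[of "N + m"] by (simp add: algebra_simps)
  qed simp
  obtain m where "d N < real m * \<delta>" using reals_Archimedean3[OF \<open>\<delta> > 0\<close>] by blast
  moreover have "\<delta> * real m \<le> \<delta> * real (Suc m)" using \<open>\<delta> > 0\<close> by (intro mult_left_mono) auto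
  ultimately have "d (N + Suc m) < 0" using le[of "Suc m"] by (simp add: algebra_simps)
  with nonneg[of "N + Suc m"] show False by simp
qed

text \<open>
  The quantity \<open>(n + \<sigma>) * (pi - jacobi_theta \<alpha> \<beta> n n)\<close> would eventually drop by a fixed amount at
  every step.
\<close>

lemma scaled_monotonicity_fails:
  assumes \<alpha>: "\<alpha> > -1" and \<beta>: "\<beta> > -1" and \<beta>2: "\<bar>\<beta>\<bar> > 1/2" and \<sigma>: "\<sigma> > -1"
    and mono: "\<And>n k. 1 \<le> n \<Longrightarrow> 1 \<le> k \<Longrightarrow> k \<le> n \<Longrightarrow>
      (real n + \<sigma>) * jacobi_theta \<alpha> \<beta> n k \<le> (real n + 1 + \<sigma>) * jacobi_theta \<alpha> \<beta> (n + 1) k"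
  shows False
proof -
  obtain \<kappa> where \<kappa>: "0 < \<kappa>" "\<kappa> < 1" and gap: "\<forall>\<^sub>F n in sequentially.
      pi / (\<kappa> * real n) < jacobi_theta \<alpha> \<beta> n n - jacobi_theta \<alpha> \<beta> n (n - 1)"
    using last_jacobi_gap_large[OF \<alpha> \<beta> \<beta>2] by blast
  \<comment> \<open>Half of the relative excess \<open>1 / \<kappa> - 1\<close> of the gap; the other half absorbs \<open>\<sigma>\<close>.\<close>
  define \<delta> where "\<delta> = (1 / \<kappa> - 1) / 2"
  have \<delta>: "\<delta> > 0" "(1 + \<delta>) * \<kappa> < 1" using \<kappa> by (auto simp: \<delta>_def field_simps)
  have ev: "\<forall>\<^sub>F n in sequentially. (1 + \<delta>) * \<kappa> * real (Suc n) \<le> real (Suc n) + \<sigma>"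
    using \<delta>(2) by real_asymp
  have gap': "\<forall>\<^sub>F n in sequentially.
      pi / (\<kappa> * real (Suc n)) < jacobi_theta \<alpha> \<beta> (Suc n) (Suc n) - jacobi_theta \<alpha> \<beta> (Suc n) n"
    using gap[THEN eventually_all_ge_at_top] eventually_sequentially_Suc[THEN iffD2, OF gap] by simp
  define d where "d n = (real n + \<sigma>) * (pi - jacobi_theta \<alpha> \<beta> n n)" for n
  show False
  proof (rule no_eventual_steady_decrease[of "pi * \<delta>" d])
    show "pi * \<delta> > 0" using \<delta> by simp
    show "d n \<ge> 0" if "n \<ge> 1" for n
      using jacobi_theta_in_angles[OF \<alpha> \<beta> that, of n] that \<sigma>
      unfolding d_def by (intro mult_nonneg_nonneg) (auto simp: jacobi_angles_def)
    show "\<forall>\<^sub>F n in sequentially. d (Suc n) \<le> d n - pi * \<delta>"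
      using ev gap' eventually_ge_at_top[of 1]
    proof eventually_elim
      case (elim n)
      let ?N = "real (Suc n)"
      let ?g = "jacobi_theta \<alpha> \<beta> (Suc n) (Suc n) - jacobi_theta \<alpha> \<beta> (Suc n) n"
      have "pi * (1 + \<delta>) = pi / (\<kappa> * ?N) * ((1 + \<delta>) * \<kappa> * ?N)" using \<kappa> by simp
      also have "\<dots> \<le> ?g * (?N + \<sigma>)"
      proof (rule mult_mono)
        show "pi / (\<kappa> * ?N) \<le> ?g" using elim(2) by simp
        moreover have "pi / (\<kappa> * ?N) > 0" using \<kappa> by simp
        ultimately show "0 \<le> ?g" by linarith
      qed (use elim(1) \<kappa> \<delta> in auto)
      finally have "pi * (1 + \<delta>) \<le> (?N + \<sigma>) * ?g" by (simp add: mult.commute)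
      moreover have "(real n + \<sigma>) * jacobi_theta \<alpha> \<beta> n n \<le> (?N + \<sigma>) * jacobi_theta \<alpha> \<beta> (Suc n) n"
        using mono[of n n] elim(3) by (simp add: add_ac)
      ultimately show ?case unfolding d_def by (simp add: algebra_simps)
    qed
  qed
qed

theorem corollary2p3:
  fixes \<alpha> \<beta> :: real
  assumes "\<alpha> > -1" and "\<beta> > -1"
  shows "(\<exists>\<sigma>::real. \<sigma> > -1 \<and>
            (\<forall>n::nat. \<forall>k::nat. 1 \<le> n \<longrightarrow> 1 \<le> k \<longrightarrow> k \<le> n \<longrightarrow>
               (real n + \<sigma>) * jacobi_theta \<alpha> \<beta> n k
                 \<le> (real n + 1 + \<sigma>) * jacobi_theta \<alpha> \<beta> (n + 1) k))
         \<longleftrightarrow> \<bar>\<beta>\<bar> \<le> 1/2"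
proof
  assume "\<bar>\<beta>\<bar> \<le> 1/2"
  then have "(real n + (-1/2)) * jacobi_theta \<alpha> \<beta> n k
      \<le> (real n + 1 + (-1/2)) * jacobi_theta \<alpha> \<beta> (n + 1) k" if "1 \<le> n" "1 \<le> k" "k \<le> n" for n k
    using jacobi_theta_scaled_mono[OF assms(1) _ that] by (simp add: add.commute)
  then show "\<exists>\<sigma>::real. \<sigma> > -1 \<and> (\<forall>n::nat. \<forall>k::nat. 1 \<le> n \<longrightarrow> 1 \<le> k \<longrightarrow> k \<le> n \<longrightarrow>
      (real n + \<sigma>) * jacobi_theta \<alpha> \<beta> n k \<le> (real n + 1 + \<sigma>) * jacobi_theta \<alpha> \<beta> (n + 1) k)"
    by (intro exI[of _ "-1/2"] conjI allI impI) simp_all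
next
  assume "\<exists>\<sigma>::real. \<sigma> > -1 \<and> (\<forall>n::nat. \<forall>k::nat. 1 \<le> n \<longrightarrow> 1 \<le> k \<longrightarrow> k \<le> n \<longrightarrow>
      (real n + \<sigma>) * jacobi_theta \<alpha> \<beta> n k \<le> (real n + 1 + \<sigma>) * jacobi_theta \<alpha> \<beta> (n + 1) k)"
  then show "\<bar>\<beta>\<bar> \<le> 1/2"
    using scaled_monotonicity_fails[OF assms] by (metis not_le)
qed

end
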